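(* (i) Let $A\in\mathbb{Z}^{m\times n}$ with $m\ge n$ and $\operatorname{rank}(A)=n$, and let $B\in\mathbb{Z}^{n\times n}$ be an invertible matrix. If (SHC) holds for $C(A)$, then (SHC) holds for $C(AB)$. (ii) It suffices to prove (SHC) when $\gcd(A)=1$: if (SHC) holds for $C(A)$ for all full column rank integer matrices $A$ (with at least as many rows as columns) satisfying $\gcd(A)=1$, then (SHC) holds for $C(A)$ for all full column rank integer matrices $A$ (with at least as many rows as columns).
   Context: Notation: $[m]=\{1,\dots,m\}$; $A_{I,\cdot}$ is the submatrix of $A$ with rows indexed by $I$, and $A_{I,J}$ the submatrix with rows in $I$ and columns in $J$. For an integer matrix $M$ with at least as many rows as columns, say $q$ columns, $\gcd(M)$ is the gcd of all $q\times q$ minors of $M$, and $\gcd(M^T):=\gcd(M)$; so for an $(n-1)\times n$ matrix it is the gcd of its $(n-1)\times(n-1)$ minors. For $A\in\mathbb{Z}^{m\times n}$ with $m\ge n$ and full column rank, $C(A):=\{x\in\mathbb{R}^n: Ax\ge 0\}$, a rational pointed cone. An extreme ray is a 1-dimensional face. Hilbert basis: a nonzero $h\in C(A)\cap\mathbb{Z}^n$ is a Hilbert basis element of $C(A)$ with respect to $\mathbb{Z}^n$ if for all $z^1,z^2\in C(A)\cap\mathbb{Z}^n$ with $h=z^1+z^2$ we have $z^1=0$ or $z^2=0$. Normalized generators: for each extreme ray of $C(A)$, consider all $I\subseteq[m]$ with $|I|=n-1$, $\operatorname{rank}(A_{I,\cdot})=n-1$ and $A_{I,\cdot}r=0$ for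 $r$ on the ray; choose such an $I$ with $\gcd(A_{I,\cdot})$ maximal. The normalized generator of the ray is the vector $r$ on the ray with $r_i=(-1)^i\det A_{I,[n]\setminus\{i\}}$ for $i=1,\dots,n$, up to a global sign chosen so that $r\in C(A)$ (equivalently, $\gcd(A_{I,\cdot})$ times the primitive integer vector on the ray). $R(A)$ is the set of normalized generators. (SHC) holds for $C(A)$ (with the given matrix $A$) if every Hilbert basis element $h$ of $C(A)$ with respect to $\mathbb{Z}^n$ lies in $\operatorname{conv}(\{0\}\cup R(A))$, equivalently if every such $h$ can be written as $h=\sum_{r\in R(A)}\lambda_r r$ with $\lambda_r\ge 0$ and $\sum_r\lambda_r\le 1$. *)

theory Defs
  imports "Jordan_Normal_Form.DL_Rank_Submatrix"
begin

text \<open>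
  Dimensions vary inside the statement, so vectors and matrices are those of
  Jordan_Normal_Form. Rows, columns and coordinates are indexed from 0, i.e. the index
  set \<open>[m]\<close> is \<open>{..<m}\<close>.
\<close>

abbreviation real_mat :: "int mat \<Rightarrow> real mat" where
  "real_mat \<equiv> map_mat real_of_int"

abbreviation real_vec :: "int vec \<Rightarrow> real vec" where
  "real_vec \<equiv> map_vec real_of_int"

definition int_rank :: "int mat \<Rightarrow> nat" where
  "int_rank M = vec_space.rank (dim_row M) (real_mat M)"

definition full_col_rank :: "nat \<Rightarrow> nat \<Rightarrow> int mat \<Rightarrow> bool" where
  "full_col_rank m n A \<longleftrightarrow> A \<in> carrier_mat m n \<and> n \<le> m \<and> int_rank A = n"

text \<open>
  The gcd of all \<open>q \<times> q\<close> minors, where \<open>q\<close> is the number of columns for a matrix with at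
  least as many rows as columns, and the number of rows in the transposed situation.
\<close>
definition mat_gcd :: "int mat \<Rightarrow> int" where
  "mat_gcd M = Gcd {det (submatrix M I J) | I J.
     I \<subseteq> {..<dim_row M} \<and> J \<subseteq> {..<dim_col M} \<and>
     card I = min (dim_row M) (dim_col M) \<and> card J = min (dim_row M) (dim_col M)}"

text \<open>
  The order on vectors is the componentwise one.
\<close>
definition cone_of :: "int mat \<Rightarrow> real vec set" where
  "cone_of A = {x \<in> carrier_vec (dim_col A). 0\<^sub>v (dim_row A) \<le> real_mat A *\<^sub>v x}"

text \<open>
  The dimension of a nonempty set is the dimension of the linear space parallel to its
  affine hull.
\<close>
definition (in vec_space) affine_dim :: "'a vec set \<Rightarrow> nat" where
  "affine_dim S = vectorspace.dim class_ring (span_vs {x - y | x y. x \<in> S \<and> y \<in> S})"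

text \<open>
  Faces of a polyhedron are the nonempty sets of points at which an inequality valid for
  the polyhedron is tight; \<open>c = 0\<close> gives the polyhedron itself.
\<close>
definition is_face :: "nat \<Rightarrow> real vec set \<Rightarrow> real vec set \<Rightarrow> bool" where
  "is_face n P F \<longleftrightarrow> F \<noteq> {} \<and>
     (\<exists>c \<in> carrier_vec n. \<exists>\<delta>. (\<forall>x \<in> P. \<delta> \<le> c \<bullet> x) \<and> F = {x \<in> P. c \<bullet> x = \<delta>})"

definition extreme_ray :: "int mat \<Rightarrow> real vec set \<Rightarrow> bool" where
  "extreme_ray A F \<longleftrightarrow>
     is_face (dim_col A) (cone_of A) F \<and> vec_space.affine_dim (dim_col A) F = 1"

definition hilbert_basis_element :: "int mat \<Rightarrow> int vec \<Rightarrow> bool" where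
  "hilbert_basis_element A h \<longleftrightarrow>
     h \<noteq> 0\<^sub>v (dim_col A) \<and> real_vec h \<in> cone_of A \<and>
     (\<forall>z1 z2. real_vec z1 \<in> cone_of A \<and> real_vec z2 \<in> cone_of A \<and> h = z1 + z2 \<longrightarrow>
        z1 = 0\<^sub>v (dim_col A) \<or> z2 = 0\<^sub>v (dim_col A))"

definition ray_index_sets :: "int mat \<Rightarrow> real vec set \<Rightarrow> nat set set" where
  "ray_index_sets A F = {I. I \<subseteq> {..<dim_row A} \<and> card I = dim_col A - 1 \<and>
     int_rank (submatrix A I UNIV) = dim_col A - 1 \<and>
     (\<forall>x \<in> F. real_mat (submatrix A I UNIV) *\<^sub>v x = 0\<^sub>v (dim_col A - 1))}"

text \<open>
  The entry at position \<open>i\<close> has the sign of the 1-based index \<open>i + 1\<close>.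
\<close>
definition minor_vec :: "int mat \<Rightarrow> nat set \<Rightarrow> int vec" where
  "minor_vec A I =
     vec (dim_col A) (\<lambda>i. (-1) ^ (i + 1) * det (submatrix A I ({..<dim_col A} - {i})))"

text \<open>
  All maximizing index sets of a ray give the same generator, so no choice of one of them
  is fixed.
\<close>
definition normalized_generators :: "int mat \<Rightarrow> int vec set" where
  "normalized_generators A = {r. \<exists>F I. extreme_ray A F \<and> I \<in> ray_index_sets A F \<and>
     (\<forall>J \<in> ray_index_sets A F.
        mat_gcd (submatrix A J UNIV) \<le> mat_gcd (submatrix A I UNIV)) \<and>
     real_vec r \<in> F \<and> (r = minor_vec A I \<or> r = - minor_vec A I)}"

definition conv_hull :: "nat \<Rightarrow> real vec set \<Rightarrow> real vec set" where
  "conv_hull n S = {vec n (\<lambda>i. \<Sum>v\<in>T. c v * v $ i) | T c.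
     finite T \<and> T \<subseteq> S \<and> (\<forall>v \<in> T. 0 \<le> c v) \<and> sum c T = 1}"

definition SHC :: "int mat \<Rightarrow> bool" where
  "SHC A \<longleftrightarrow> (\<forall>h. hilbert_basis_element A h \<longrightarrow>
     real_vec h \<in>
       conv_hull (dim_col A) ({0\<^sub>v (dim_col A)} \<union> real_vec ` normalized_generators A))"

end

theory Submission
  imports Defs "HOL-Number_Theory.Cong"
begin

text \<open>
  Let \<open>B\<close> be an invertible integer matrix, \<open>d = \<bar>det B\<bar>\<close> and \<open>L = B \<int>\<^sup>n\<close>, a lattice of index \<open>d\<close> in
  \<open>\<int>\<^sup>n\<close>. Multiplication by \<open>B\<close> turns the pair of \<open>C(AB)\<close> and \<open>\<int>\<^sup>n\<close> into the pair of \<open>C(A)\<close> and \<open>L\<close>.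
  The minors of \<open>AB\<close> satisfy \<open>B \<cdot> minor_vec (AB) I = det B \<cdot> minor_vec A I\<close>; hence the same index sets
  \<open>I\<close> are maximizing on both sides, and every \<open>r \<in> R(A)\<close> gives the normalized generator
  \<open>B\<inverse> (d r)\<close> of \<open>C(AB)\<close> (lemma \<open>normalized_generator_preimage\<close>).

  Let \<open>h\<close> be a Hilbert basis element of \<open>C(AB)\<close>, and write \<open>B h\<close> as a sum of Hilbert basis elements
  of \<open>C(A)\<close>. With more than \<open>d\<close> summands, two of the first \<open>d + 1\<close> partial sums (the empty one
  included) are congruent modulo \<open>L\<close>, so a proper nonempty block of the summands adds up to an element
  of \<open>L\<close>, and \<open>B h\<close> would split inside \<open>C(A) \<inter> L\<close>. So there are at most \<open>d\<close> summands. By (SHC) for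
  \<open>A\<close> each of them lies in \<open>conv ({0} \<union> R(A))\<close>; thus \<open>B h \<in> d conv ({0} \<union> R(A))\<close>, and applying
  \<open>B\<inverse>\<close> puts \<open>h\<close> into \<open>conv ({0} \<union> R(AB))\<close> (lemma \<open>SHC_mult_cyclic\<close>).

  The index of \<open>L\<close> is never computed. Lemma \<open>extract_prime_step\<close> says that if a prime \<open>p\<close> divides all
  maximal minors of \<open>A\<close>, then \<open>A = A' E\<close> with \<open>det E = p\<close> and \<open>E \<int>\<^sup>n = {z. p dvd z\<^sub>j}\<close> for some
  coordinate \<open>j\<close> (see \<open>prime_step_image\<close>): the class of \<open>z\<close> modulo \<open>E \<int>\<^sup>n\<close> is the residue of \<open>z\<^sub>j\<close> modulo \<open>p\<close>. Splitting such
  factors off \<open>B\<close> until \<open>\<bar>det B\<bar> = 1\<close> proves (i) one factor at a time. Splitting them off \<open>A\<close> divides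
  \<open>gcd(A)\<close> by \<open>p\<close> each time; this ends with a matrix of gcd 1, from which (SHC) is carried back to
  \<open>A\<close>, and that is (ii).
\<close>

section \<open>Minors and kernel vectors\<close>

text \<open>
  Let \<open>k\<close> be least such that \<open>p\<close> divides all \<open>k \<times> k\<close> minors taken from the first \<open>k\<close> columns, and fix
  \<open>k - 1\<close> rows whose minor in the first \<open>k - 1\<close> columns is not divisible by \<open>p\<close>. Appending a row \<open>i\<close> of
  \<open>A\<close> gives a \<open>k \<times> k\<close> minor that \<open>p\<close> divides. Its expansion along the appended row is the \<open>i\<close>-th entry of
  \<open>A v\<close>, where \<open>v\<close> is the vector of cofactors, which does not depend on \<open>i\<close>.
  For \<open>p = 0\<close> this is a criterion for a nonzero kernel vector, for a prime \<open>p\<close> a kernel vector modulo \<open>p\<close>.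
\<close>

lemma minors_dvd_imp_kernel_vector:
  fixes A :: "'a :: comm_ring_1 mat"
  assumes A: "A \<in> carrier_mat m n" and p: "\<not> p dvd 1"
    and minors: "\<And>f. (\<And>a. a < n \<Longrightarrow> f a < m) \<Longrightarrow> p dvd det (mat n n (\<lambda>(a, b). A $$ (f a, b)))"
  obtains v j where "v \<in> carrier_vec n" "j < n" "\<not> p dvd v $ j"
    "\<And>i. i < m \<Longrightarrow> p dvd (A *\<^sub>v v) $ i"
proof -
  define D where "D k f = det (mat k k (\<lambda>(a, b). A $$ (f a, b)))" for k :: nat and f :: "nat \<Rightarrow> nat"
  define P where "P k \<longleftrightarrow> (\<forall>f. (\<forall>a<k. f a < m) \<longrightarrow> p dvd D k f)" for k
  have Pn: "P n" using minors unfolding P_def D_def by auto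
  define k where "k = (LEAST k. P k)"
  have Pk: "P k" unfolding k_def by (rule LeastI[of P, OF Pn])
  have kn: "k \<le> n" unfolding k_def by (rule Least_le[of P, OF Pn])
  have "\<not> P 0" using p unfolding P_def D_def by (simp add: det_dim_zero)
  with Pk have "k \<noteq> 0" by metis
  then obtain l where kl: "k = Suc l" by (cases k) auto
  have "\<not> P l" using not_less_Least[of l P] unfolding k_def[symmetric] kl by simp
  then obtain f where f: "\<And>a. a < l \<Longrightarrow> f a < m" and fD: "\<not> p dvd D l f"
    unfolding P_def by auto
  define c where "c b = (-1) ^ (l + b) *
    det (mat l l (\<lambda>(a, b'). A $$ (f a, if b' < b then b' else Suc b')))" for b
  define v where "v = vec n (\<lambda>b. if b < k then c b else 0)"
  have v: "v \<in> carrier_vec n" by (simp add: v_def)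
  have "mat l l (\<lambda>(a, b'). A $$ (f a, if b' < l then b' else Suc b')) = mat l l (\<lambda>(a, b). A $$ (f a, b))"
    by (rule eq_matI) auto
  then have "c l = D l f" unfolding c_def D_def by simp
  then have vl: "\<not> p dvd v $ l" using fD kn kl by (simp add: v_def)
  have Av: "p dvd (A *\<^sub>v v) $ i" if i: "i < m" for i
  proof -
    define N where "N = mat k k (\<lambda>(a, b). A $$ (if a < l then f a else i, b))"
    have N: "N \<in> carrier_mat k k" by (simp add: N_def)
    have "N = mat k k (\<lambda>(a, b). A $$ ((\<lambda>a. if a < l then f a else i) a, b))"
      unfolding N_def by simp
    then have "det N = D k (\<lambda>a. if a < l then f a else i)" unfolding D_def by simp
    then have dv: "p dvd det N" using Pk f i unfolding P_def by auto
    have del: "mat_delete N l b = mat l l (\<lambda>(a, b'). A $$ (f a, if b' < b then b' else Suc b'))"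
      if "b < k" for b
      unfolding mat_delete_def by (rule eq_matI) (use that in \<open>auto simp: N_def kl\<close>)
    have "det N = (\<Sum>b<k. N $$ (l, b) * cofactor N l b)"
      by (rule laplace_expansion_row[OF N]) (simp add: kl)
    also have "\<dots> = (\<Sum>b<k. A $$ (i, b) * c b)"
    proof (rule sum.cong)
      fix b assume "b \<in> {..<k}"
      then have b: "b < k" by simp
      have "N $$ (l, b) = A $$ (i, b)" using b by (simp add: N_def kl)
      then show "N $$ (l, b) * cofactor N l b = A $$ (i, b) * c b"
        by (simp add: cofactor_def del[OF b] c_def)
    qed simp
    also have "\<dots> = (\<Sum>b<n. A $$ (i, b) * (if b < k then c b else 0))"
      by (rule sum.mono_neutral_cong_left) (use kn in auto)
    also have "\<dots> = (A *\<^sub>v v) $ i"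
      using A i by (auto simp: scalar_prod_def v_def atLeast0LessThan intro!: sum.cong)
    finally show ?thesis using dv by simp
  qed
  show ?thesis by (rule that[OF v _ vl Av]) (use kn kl in auto)
qed

lemma card_index_set: "I \<subseteq> {..<m} \<Longrightarrow> card {i. i < m \<and> i \<in> I} = card I"
  by (rule arg_cong[of _ _ card]) auto

lemma submatrix_rows_carrier:
  "A \<in> carrier_mat m n \<Longrightarrow> I \<subseteq> {..<m} \<Longrightarrow> submatrix A I UNIV \<in> carrier_mat (card I) n"
  by (auto simp: dim_submatrix card_index_set)

lemma submatrix_rows_index:
  assumes "A \<in> carrier_mat m n" "I \<subseteq> {..<m}" "i < card I" "j < n"
  shows "submatrix A I UNIV $$ (i, j) = A $$ (pick I i, j)"
  by (subst submatrix_index) (use assms in \<open>auto simp: card_index_set pick_UNIV\<close>)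

lemma submatrix_all_rows:
  assumes A: "A \<in> carrier_mat m n"
  shows "submatrix A {..<m} UNIV = A"
proof (rule eq_matI)
  fix a b assume "a < dim_row A" "b < dim_col A"
  then have ab: "a < m" "b < n" using A by auto
  have "{x \<in> {..<m}. x < a} = {..<a}" using ab by auto
  then have "pick {..<m} a = a" using pick_card_in_set[of a "{..<m}"] ab by simp
  then show "submatrix A {..<m} UNIV $$ (a, b) = A $$ (a, b)"
    using submatrix_rows_index[OF A, of "{..<m}" a b] ab by simp
qed (use submatrix_rows_carrier[OF A, of "{..<m}"] A in auto)

lemma pick_index_set: "I \<subseteq> {..<m} \<Longrightarrow> i < card I \<Longrightarrow> pick I i < (m::nat)"
  using pick_in_set_le[of i I] by blast

text \<open>
  A selection of rows with a repetition has determinant 0; an injective one is a row permutation of a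
  submatrix.
\<close>

lemma dvd_all_row_selections:
  fixes A :: "'a :: comm_ring_1 mat"
  assumes A: "A \<in> carrier_mat m n"
    and p: "\<And>I. I \<subseteq> {..<m} \<Longrightarrow> card I = n \<Longrightarrow> p dvd det (submatrix A I UNIV)"
    and f: "\<And>a. a < n \<Longrightarrow> f a < m"
  shows "p dvd det (mat n n (\<lambda>(a, b). A $$ (f a, b)))"
proof (cases "inj_on f {..<n}")
  case False
  then obtain a b where ab: "a < n" "b < n" "a \<noteq> b" "f a = f b" by (auto simp: inj_on_def)
  have "det (mat n n (\<lambda>(a, b). A $$ (f a, b))) = 0"
    by (rule det_identical_rows[OF _ ab(3,1,2)]) (use ab in \<open>auto\<close>)
  then show ?thesis by simp
next
  case True
  define I where "I = f ` {..<n}"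
  have I: "I \<subseteq> {..<m}" using f by (auto simp: I_def)
  have cI: "card I = n" using card_image[OF True] by (simp add: I_def)
  have fin: "finite I" by (simp add: I_def)
  \<comment> \<open>the position of the row \<open>f a\<close> inside \<open>I\<close>\<close>
  define s where "s a = (if a < n then card {x \<in> I. x < f a} else a)" for a
  have pick: "pick I (s a) = f a" if "a < n" for a
    unfolding s_def using that by (simp add: pick_card_in_set I_def)
  have sn: "s a < n" if "a < n" for a
  proof -
    have "card {x \<in> I. x < f a} < card I"
      by (rule psubset_card_mono[OF fin]) (use that in \<open>auto simp: I_def\<close>)
    then show ?thesis using that cI by (simp add: s_def)
  qed
  have inj: "inj_on s {0..<n}"
    by (rule inj_onI) (metis True atLeastLessThan_iff inj_on_def lessThan_iff pick)
  have "s permutes {0..<n}"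
  proof (rule bij_imp_permutes)
    have "s ` {0..<n} \<subseteq> {0..<n}" using sn by auto
    with inj show "bij_betw s {0..<n} {0..<n}"
      unfolding bij_betw_def by (simp add: endo_inj_surj)
  qed (simp add: s_def)
  moreover have S: "submatrix A I UNIV \<in> carrier_mat n n"
    using submatrix_rows_carrier[OF A I] cI by simp
  ultimately have "det (mat n n (\<lambda>(a, b). submatrix A I UNIV $$ (s a, b)))
      = signof s * det (submatrix A I UNIV)"
    using det_permute_rows by blast
  moreover have "mat n n (\<lambda>(a, b). submatrix A I UNIV $$ (s a, b)) = mat n n (\<lambda>(a, b). A $$ (f a, b))"
    by (rule eq_matI) (auto simp: submatrix_rows_index[OF A I] cI sn pick)
  ultimately show ?thesis using p[OF I cI] by simp
qed

lemma row_minors_dvd_imp_kernel_vector: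
  fixes A :: "'a :: comm_ring_1 mat"
  assumes "A \<in> carrier_mat m n" and "\<not> p dvd 1"
    and "\<And>I. I \<subseteq> {..<m} \<Longrightarrow> card I = n \<Longrightarrow> p dvd det (submatrix A I UNIV)"
  obtains v j where "v \<in> carrier_vec n" "j < n" "\<not> p dvd v $ j"
    "\<And>i. i < m \<Longrightarrow> p dvd (A *\<^sub>v v) $ i"
  using minors_dvd_imp_kernel_vector[OF assms(1,2) dvd_all_row_selections[OF assms(1,3)]] by blast

lemma injective_imp_nonzero_minor:
  fixes A :: "int mat"
  assumes A: "A \<in> carrier_mat m n"
    and inj: "\<And>x. x \<in> carrier_vec n \<Longrightarrow> A *\<^sub>v x = 0\<^sub>v m \<Longrightarrow> x = 0\<^sub>v n"
  obtains I where "I \<subseteq> {..<m}" "card I = n" "det (submatrix A I UNIV) \<noteq> 0"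
proof (rule ccontr)
  assume no_minor: "\<not> thesis"
  note witness = that
  have minors: "0 dvd det (submatrix A I UNIV)" if "I \<subseteq> {..<m}" "card I = n" for I
  proof (cases "det (submatrix A I UNIV) = 0")
    case False
    with no_minor witness[OF that] show ?thesis by blast
  qed simp
  have "\<not> 0 dvd (1 :: int)" by simp
  then obtain v j where v: "v \<in> carrier_vec n" "j < n" "\<not> 0 dvd v $ j"
    "\<And>i. i < m \<Longrightarrow> 0 dvd (A *\<^sub>v v) $ i"
    using row_minors_dvd_imp_kernel_vector[OF A _ minors] by blast
  have "A *\<^sub>v v = 0\<^sub>v m" by (rule eq_vecI) (use v(4) A in auto)
  from inj[OF v(1) this] v(2,3) show False by simp
qed

section \<open>Rank of integer matrices\<close>

lemma real_mat_mult_vec: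
  "x \<in> carrier_vec (dim_col A) \<Longrightarrow> real_mat A *\<^sub>v real_vec x = real_vec (A *\<^sub>v x)"
  by (rule eq_vecI) (auto simp: scalar_prod_def)

lemma real_vec_eq_0: "real_vec x = 0\<^sub>v n \<longleftrightarrow> x = 0\<^sub>v n"
  by (auto simp: vec_eq_iff)

lemma real_submatrix: "submatrix (real_mat A) I J = real_mat (submatrix A I J)"
proof (rule eq_matI)
  fix i j
  assume "i < dim_row (real_mat (submatrix A I J))" "j < dim_col (real_mat (submatrix A I J))"
  then have ij: "i < card {i. i < dim_row A \<and> i \<in> I}" "j < card {j. j < dim_col A \<and> j \<in> J}"
    by (auto simp: dim_submatrix)
  then have "pick I i < dim_row A" "pick J j < dim_col A" by (auto intro: pick_le)
  with ij show "submatrix (real_mat A) I J $$ (i, j) = real_mat (submatrix A I J) $$ (i, j)"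
    by (simp add: submatrix_index dim_submatrix)
qed (auto simp: dim_submatrix)

text \<open>
  A maximal independent set of columns has as many elements as there are columns, so the columns are
  pairwise distinct and independent.
\<close>

lemma rank_eq_cols_imp_injective:
  fixes A :: "real mat"
  assumes A: "A \<in> carrier_mat m n" and r: "vec_space.rank m A = n"
    and x: "x \<in> carrier_vec n" "A *\<^sub>v x = 0\<^sub>v m"
  shows "x = 0\<^sub>v n"
proof (rule ccontr)
  assume x0: "x \<noteq> 0\<^sub>v n"
  interpret vec_space "TYPE(real)" m .
  obtain S where S: "maximal S (\<lambda>T. T \<subseteq> set (cols A) \<and> lin_indpt T)"
    using maximal_exists[of "(\<lambda>T. T \<subseteq> set (cols A) \<and> lin_indpt T)" "card (set (cols A))" "{}"]
    by (meson List.finite_set card_mono empty_iff empty_subsetI finite_lin_indpt2 rev_finite_subset)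
  have "n = card S" using rank_card_indpt[OF A S] r by simp
  also have "\<dots> \<le> card (set (cols A))" using S by (simp add: card_mono maximal_def)
  finally have "card (set (cols A)) = length (cols A)"
    using A card_length[of "cols A"] by auto
  then have d: "distinct (cols A)" by (rule card_distinct)
  from full_rank_lin_indpt[OF A r d] lin_depI[OF A x(1) x0 x(2) d] show False by simp
qed

lemma nonzero_minor_imp_int_rank_eq_cols:
  assumes A: "A \<in> carrier_mat m n" and I: "I \<subseteq> {..<m}" "card I = n"
    and nz: "det (submatrix A I UNIV) \<noteq> 0"
  shows "int_rank A = n"
proof -
  have rA: "real_mat A \<in> carrier_mat m n" using A by simp
  have "det (submatrix (real_mat A) I UNIV) \<noteq> 0"
    unfolding real_submatrix of_int_hom.hom_det using nz by simp
  from vec_space.rank_gt_minor[OF rA this] have "n \<le> vec_space.rank m (real_mat A)" by simp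
  with vec_space.rank_le_nc[OF rA] A show ?thesis unfolding int_rank_def by simp
qed

text \<open>
  If the map is injective, the case \<open>p = 0\<close> of the kernel criterion gives a nonzero maximal minor.
\<close>

lemma int_rank_eq_cols_iff:
  assumes A: "A \<in> carrier_mat m n"
  shows "int_rank A = n \<longleftrightarrow>
    (\<forall>x \<in> carrier_vec n. real_mat A *\<^sub>v x = 0\<^sub>v m \<longrightarrow> x = 0\<^sub>v n)"
proof
  assume "int_rank A = n"
  then have "vec_space.rank m (real_mat A) = n" using A by (simp add: int_rank_def)
  with rank_eq_cols_imp_injective[of "real_mat A" m n] A
  show "\<forall>x \<in> carrier_vec n. real_mat A *\<^sub>v x = 0\<^sub>v m \<longrightarrow> x = 0\<^sub>v n" by auto
next
  assume inj: "\<forall>x \<in> carrier_vec n. real_mat A *\<^sub>v x = 0\<^sub>v m \<longrightarrow> x = 0\<^sub>v n"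
  have "x = 0\<^sub>v n" if x: "x \<in> carrier_vec n" "A *\<^sub>v x = 0\<^sub>v m" for x
  proof -
    have "real_mat A *\<^sub>v real_vec x = 0\<^sub>v m"
      using real_mat_mult_vec[of x A] x A by (auto simp: real_vec_eq_0)
    with inj x(1) have "real_vec x = 0\<^sub>v n" by auto
    then show ?thesis by (simp add: real_vec_eq_0)
  qed
  from injective_imp_nonzero_minor[OF A this] obtain I where
    "I \<subseteq> {..<m}" "card I = n" "det (submatrix A I UNIV) \<noteq> 0" by blast
  from nonzero_minor_imp_int_rank_eq_cols[OF A this] show "int_rank A = n" .
qed

lemma full_rank_imp_injective:
  assumes A: "A \<in> carrier_mat m n" and rank: "int_rank A = n"
    and x: "x \<in> carrier_vec n" "A *\<^sub>v x = 0\<^sub>v m"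
  shows "x = 0\<^sub>v n"
proof -
  have "real_mat A *\<^sub>v real_vec x = 0\<^sub>v m"
    using real_mat_mult_vec[of x A] x A by (auto simp: real_vec_eq_0)
  then have "real_vec x = 0\<^sub>v n" using rank int_rank_eq_cols_iff[OF A] x(1) by auto
  then show ?thesis by (simp add: real_vec_eq_0)
qed

section \<open>The vector of maximal minors\<close>

text \<open>
  For a matrix with one column more than rows this is, up to a global sign, the generalized cross product
  of its rows.
\<close>

definition signed_minors :: "int mat \<Rightarrow> int vec" where
  "signed_minors M = vec (dim_col M) (\<lambda>i. (-1) ^ (i + 1) *
     det (mat (dim_row M) (dim_col M - 1) (\<lambda>(a, b). M $$ (a, if b < i then b else Suc b))))"

lemma signed_minors_carrier: "M \<in> carrier_mat r n \<Longrightarrow> signed_minors M \<in> carrier_vec n"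
  by (simp add: signed_minors_def)

lemma pick_all_but_one:
  assumes "i < n" "b < n - 1"
  shows "pick ({..<n} - {i}) b = (if b < i then b else Suc b)"
proof -
  let ?c = "if b < i then b else Suc b"
  have "{a \<in> {..<n} - {i}. a < ?c} = (if b < i then {..<b} else {..<Suc b} - {i})"
    using assms by auto
  then have "card {a \<in> {..<n} - {i}. a < ?c} = b" by (simp add: not_less)
  moreover have "?c \<in> {..<n} - {i}" using assms by auto
  ultimately show ?thesis using pick_card_in_set[of ?c "{..<n} - {i}"] by simp
qed

lemma submatrix_drop_col:
  assumes A: "A \<in> carrier_mat m n" and I: "I \<subseteq> {..<m}" and i: "i < n"
  shows "submatrix A I ({..<n} - {i}) = mat (card I) (n - 1)
    (\<lambda>(a, b). submatrix A I UNIV $$ (a, if b < i then b else Suc b))"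
proof (rule eq_matI)
  let ?R = "mat (card I) (n - 1)
    (\<lambda>(a, b). submatrix A I UNIV $$ (a, if b < i then b else Suc b))"
  have J: "card {j. j < n \<and> j \<in> {..<n} - {i}} = n - 1"
    using i by (subst card_index_set) auto
  have Ic: "card {i. i < m \<and> i \<in> I} = card I" by (rule card_index_set[OF I])
  show "dim_row (submatrix A I ({..<n} - {i})) = dim_row ?R" using A Ic by (auto simp: dim_submatrix)
  show "dim_col (submatrix A I ({..<n} - {i})) = dim_col ?R" using A J by (auto simp: dim_submatrix)
  fix a b assume "a < dim_row ?R" "b < dim_col ?R"
  then have ab: "a < card I" "b < n - 1" by auto
  have "submatrix A I ({..<n} - {i}) $$ (a, b) = A $$ (pick I a, pick ({..<n} - {i}) b)"
    using A ab Ic J by (subst submatrix_index) auto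
  also have "\<dots> = submatrix A I UNIV $$ (a, if b < i then b else Suc b)"
    using ab i by (simp add: pick_all_but_one submatrix_rows_index[OF A I])
  finally show "submatrix A I ({..<n} - {i}) $$ (a, b) = ?R $$ (a, b)" using ab by simp
qed

lemma minor_vec_eq_signed_minors:
  assumes A: "A \<in> carrier_mat m n" and I: "I \<subseteq> {..<m}"
  shows "minor_vec A I = signed_minors (submatrix A I UNIV)"
proof -
  have S: "submatrix A I UNIV \<in> carrier_mat (card I) n" by (rule submatrix_rows_carrier[OF A I])
  show ?thesis
    by (rule eq_vecI)
      (use S A in \<open>auto simp: minor_vec_def signed_minors_def submatrix_drop_col[OF A I]\<close>)
qed

definition prepend_row :: "int vec \<Rightarrow> int mat \<Rightarrow> int mat" where
  "prepend_row u M =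
     mat (Suc (dim_row M)) (dim_col M) (\<lambda>(i, j). if i = 0 then u $ j else M $$ (i - 1, j))"

lemma prepend_row_carrier: "M \<in> carrier_mat r n \<Longrightarrow> prepend_row u M \<in> carrier_mat (Suc r) n"
  by (simp add: prepend_row_def)

text \<open>
  Pairing with the vector of signed minors is a determinant. This turns orthogonality and the behaviour under
  multiplication by a square matrix into properties of determinants, without expanding minors of products.
\<close>

lemma det_prepend_row:
  assumes M: "M \<in> carrier_mat r (Suc r)" and u: "u \<in> carrier_vec (Suc r)"
  shows "det (prepend_row u M) = - (u \<bullet> signed_minors M)"
proof -
  let ?N = "prepend_row u M"
  have del: "mat_delete ?N 0 b = mat r (Suc r - 1) (\<lambda>(a, c). M $$ (a, if c < b then c else Suc c))"
    if "b < Suc r" for b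
    unfolding mat_delete_def prepend_row_def by (rule eq_matI) (use M that in auto)
  have "det ?N = (\<Sum>j<Suc r. ?N $$ (0, j) * cofactor ?N 0 j)"
    by (rule laplace_expansion_row) (use prepend_row_carrier[OF M] in auto)
  also have "\<dots> = (\<Sum>j<Suc r. - (u $ j * signed_minors M $ j))"
  proof (rule sum.cong)
    fix j assume "j \<in> {..<Suc r}"
    then have j: "j < Suc r" by simp
    have "?N $$ (0, j) = u $ j" using M j by (simp add: prepend_row_def)
    moreover have "cofactor ?N 0 j = - signed_minors M $ j"
      unfolding cofactor_def del[OF j] using M j by (simp add: signed_minors_def)
    ultimately show "?N $$ (0, j) * cofactor ?N 0 j = - (u $ j * signed_minors M $ j)" by simp
  qed simp
  also have "\<dots> = - (u \<bullet> signed_minors M)"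
    using signed_minors_carrier[OF M] unfolding scalar_prod_def
    by (simp add: sum_negf atLeast0LessThan del: sum.lessThan_Suc)
  finally show ?thesis .
qed

lemma mult_signed_minors_eq_0:
  assumes M: "M \<in> carrier_mat r (Suc r)"
  shows "M *\<^sub>v signed_minors M = 0\<^sub>v r"
proof (rule eq_vecI)
  fix i assume "i < dim_vec (0\<^sub>v r)"
  then have i: "i < r" by simp
  have rM: "row M i \<in> carrier_vec (Suc r)" using M i by auto
  have "det (prepend_row (row M i) M) = 0"
    by (rule det_identical_rows[OF prepend_row_carrier[OF M], of 0 "Suc i"])
      (use M i in \<open>auto simp: prepend_row_def\<close>)
  with det_prepend_row[OF M rM] show "(M *\<^sub>v signed_minors M) $ i = 0\<^sub>v r $ i"
    using M i by simp
qed (use M in auto)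

text \<open>
  Prepending row \<open>k\<close> of \<open>B\<close> to \<open>M B\<close> amounts to prepending the \<open>k\<close>-th unit vector to \<open>M\<close> and multiplying
  by \<open>B\<close>, so multiplicativity of the determinant gives entry \<open>k\<close>.
\<close>

lemma mult_signed_minors_mult:
  assumes M: "M \<in> carrier_mat r (Suc r)" and B: "B \<in> carrier_mat (Suc r) (Suc r)"
  shows "B *\<^sub>v signed_minors (M * B) = det B \<cdot>\<^sub>v signed_minors M"
proof (rule eq_vecI)
  have MB: "M * B \<in> carrier_mat r (Suc r)" using M B by simp
  show "dim_vec (B *\<^sub>v signed_minors (M * B)) = dim_vec (det B \<cdot>\<^sub>v signed_minors M)"
    using B signed_minors_carrier[OF M] by auto
  fix k assume "k < dim_vec (det B \<cdot>\<^sub>v signed_minors M)"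
  then have k: "k < Suc r" using signed_minors_carrier[OF M] by auto
  have e: "unit_vec (Suc r) k \<in> carrier_vec (Suc r)" by simp
  have "prepend_row (row B k) (M * B) = prepend_row (unit_vec (Suc r) k) M * B"
  proof (rule eq_matI)
    fix i j assume "i < dim_row (prepend_row (unit_vec (Suc r) k) M * B)"
      "j < dim_col (prepend_row (unit_vec (Suc r) k) M * B)"
    then have ij: "i < Suc r" "j < Suc r" using M B by (auto simp: prepend_row_def)
    have R: "(prepend_row (unit_vec (Suc r) k) M * B) $$ (i, j)
      = row (prepend_row (unit_vec (Suc r) k) M) i \<bullet> col B j"
      by (rule index_mult_mat(1)) (use ij M B in \<open>auto simp: prepend_row_def\<close>)
    show "prepend_row (row B k) (M * B) $$ (i, j) = (prepend_row (unit_vec (Suc r) k) M * B) $$ (i, j)"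
    proof (cases i)
      case 0
      have "row (prepend_row (unit_vec (Suc r) k) M) 0 = unit_vec (Suc r) k"
        by (rule eq_vecI) (use M in \<open>auto simp: prepend_row_def\<close>)
      then show ?thesis unfolding R using 0 ij k M B by (simp add: prepend_row_def)
    next
      case (Suc a)
      have "row (prepend_row (unit_vec (Suc r) k) M) (Suc a) = row M a"
        by (rule eq_vecI) (use M Suc ij in \<open>auto simp: prepend_row_def\<close>)
      then show ?thesis unfolding R using Suc ij k M B by (simp add: prepend_row_def)
    qed
  qed (use M B in \<open>auto simp: prepend_row_def\<close>)
  then have "det (prepend_row (row B k) (M * B)) = det (prepend_row (unit_vec (Suc r) k) M) * det B"
    using det_mult[OF prepend_row_carrier[OF M] B] by simp
  moreover have "row B k \<in> carrier_vec (Suc r)" using B k by auto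
  ultimately have "row B k \<bullet> signed_minors (M * B) = (unit_vec (Suc r) k \<bullet> signed_minors M) * det B"
    using det_prepend_row[OF MB] det_prepend_row[OF M e] by simp
  then show "(B *\<^sub>v signed_minors (M * B)) $ k = (det B \<cdot>\<^sub>v signed_minors M) $ k"
    using B k signed_minors_carrier[OF M] by (simp add: mult.commute)
qed

lemma real_scalar_prod:
  "x \<in> carrier_vec n \<Longrightarrow> y \<in> carrier_vec n \<Longrightarrow> real_vec x \<bullet> real_vec y = real_of_int (x \<bullet> y)"
  by (simp add: scalar_prod_def)

text \<open>
  With \<open>s\<close> the vector of signed minors, the square matrix with \<open>s\<close> on top of \<open>M\<close> has determinant
  \<open>- (s \<bullet> s)\<close> and is therefore regular. It annihilates \<open>(s \<bullet> s) x - (s \<bullet> x) s\<close>, which must be 0.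
\<close>

lemma kernel_on_line_signed_minors:
  assumes M: "M \<in> carrier_mat r (Suc r)" and s0: "signed_minors M \<noteq> 0\<^sub>v (Suc r)"
    and x: "x \<in> carrier_vec (Suc r)" and Mx: "real_mat M *\<^sub>v x = 0\<^sub>v r"
  shows "\<exists>t. x = t \<cdot>\<^sub>v real_vec (signed_minors M)"
proof -
  let ?n = "Suc r"
  define s where "s = real_vec (signed_minors M)"
  have sc: "signed_minors M \<in> carrier_vec ?n" by (rule signed_minors_carrier[OF M])
  then have s: "s \<in> carrier_vec ?n" by (simp add: s_def)
  define N where "N = real_mat (prepend_row (signed_minors M) M)"
  have N: "N \<in> carrier_mat ?n ?n" using prepend_row_carrier[OF M] by (simp add: N_def)
  have sne: "s \<noteq> 0\<^sub>v ?n" using s0 by (simp add: s_def real_vec_eq_0)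
  then have ss: "s \<bullet> s \<noteq> 0"
    using s conjugate_square_eq_0_vec[of s ?n] by simp
  have "det N = real_of_int (det (prepend_row (signed_minors M) M))"
    by (simp add: N_def)
  also have "\<dots> = - (s \<bullet> s)"
    unfolding det_prepend_row[OF M sc] s_def real_scalar_prod[OF sc sc] by simp
  finally have dN: "det N \<noteq> 0" using ss by simp
  define y where "y = (s \<bullet> s) \<cdot>\<^sub>v x - (s \<bullet> x) \<cdot>\<^sub>v s"
  have y: "y \<in> carrier_vec ?n" using s x by (simp add: y_def)
  have rM: "real_mat M \<in> carrier_mat r ?n" using M by simp
  have Ms: "real_mat M *\<^sub>v s = 0\<^sub>v r"
    unfolding s_def using real_mat_mult_vec[of "signed_minors M" M] M sc mult_signed_minors_eq_0[OF M]
    by (auto simp: real_vec_eq_0)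
  have My: "real_mat M *\<^sub>v y = 0\<^sub>v r"
    unfolding y_def using s x
    by (subst mult_minus_distrib_mat_vec[OF rM]) (auto simp: mult_mat_vec[OF rM] Mx Ms)
  have sy: "s \<bullet> y = 0"
    unfolding y_def using s x
    by (subst scalar_prod_minus_distrib[OF s]) (auto simp: mult.commute)
  have "N *\<^sub>v y = 0\<^sub>v ?n"
  proof (rule eq_vecI)
    fix i assume "i < dim_vec (0\<^sub>v ?n)"
    then have i: "i < ?n" by simp
    show "(N *\<^sub>v y) $ i = 0\<^sub>v ?n $ i"
    proof (cases i)
      case 0
      have "row N 0 = s" by (rule eq_vecI) (use M sc in \<open>auto simp: N_def prepend_row_def s_def\<close>)
      then show ?thesis using 0 sy N by simp
    next
      case (Suc a)
      have "row N (Suc a) = row (real_mat M) a"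
        by (rule eq_vecI) (use M Suc i in \<open>auto simp: N_def prepend_row_def\<close>)
      moreover have "(real_mat M *\<^sub>v y) $ a = 0" using My Suc i by simp
      ultimately show ?thesis using Suc i N M by simp
    qed
  qed (use N in auto)
  with det_0_iff_vec_prod_zero[OF N] dN y have y0: "y = 0\<^sub>v ?n" by blast
  have "x = ((s \<bullet> x) / (s \<bullet> s)) \<cdot>\<^sub>v s"
  proof (rule eq_vecI)
    fix i assume "i < dim_vec (((s \<bullet> x) / (s \<bullet> s)) \<cdot>\<^sub>v s)"
    then have i: "i < ?n" using s by auto
    have "y $ i = 0" using y0 i by simp
    then have "(s \<bullet> s) * x $ i = (s \<bullet> x) * s $ i"
      unfolding y_def using s x i by simp
    then show "x $ i = (((s \<bullet> x) / (s \<bullet> s)) \<cdot>\<^sub>v s) $ i" using ss s i by (simp add: field_simps)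
  qed (use s x in auto)
  then show ?thesis unfolding s_def by blast
qed

lemma rank_le_rows:
  fixes A :: "real mat"
  assumes A: "A \<in> carrier_mat m n"
  shows "vec_space.rank m A \<le> m"
proof -
  interpret vec_space "TYPE(real)" m .
  have c: "set (cols A) \<subseteq> carrier_vec m" using cols_dim A by blast
  have "vectorspace.dim class_ring (span_vs (set (cols A))) \<le> dim"
    by (rule subspace_dim[OF span_is_subspace fin_dim fin_dim_span_cols[OF A]]) (use c in simp)
  then show ?thesis unfolding rank_def dim_is_n .
qed

text \<open>
  The columns span the whole space, so \<open>y = A x\<close> for some \<open>x\<close>, and \<open>y \<bullet> y = (A\<^sup>T y) \<bullet> x = 0\<close>.
\<close>

lemma rank_eq_rows_imp_no_left_kernel:
  fixes A :: "real mat"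
  assumes A: "A \<in> carrier_mat m n" and r: "vec_space.rank m A = m"
    and y: "y \<in> carrier_vec m" "transpose_mat A *\<^sub>v y = 0\<^sub>v n"
  shows "y = 0\<^sub>v m"
proof -
  interpret vec_space "TYPE(real)" m .
  have c: "set (cols A) \<subseteq> carrier_vec m" using cols_dim A by blast
  obtain S where S: "maximal S (\<lambda>T. T \<subseteq> set (cols A) \<and> lin_indpt T)"
    using maximal_exists[of "(\<lambda>T. T \<subseteq> set (cols A) \<and> lin_indpt T)" "card (set (cols A))" "{}"]
    by (meson List.finite_set card_mono empty_iff empty_subsetI finite_lin_indpt2 rev_finite_subset)
  have S1: "S \<subseteq> set (cols A)" "lin_indpt S" using S by (auto simp: maximal_def)
  have cS: "card S = m" using rank_card_indpt[OF A S] r by simp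
  have "basis S"
    by (rule dim_li_is_basis[OF fin_dim]) (use S1 c cS dim_is_n in \<open>auto intro: finite_subset\<close>)
  then have "span S = carrier_vec m" by (simp add: basis_def)
  then have "y \<in> span (set (cols A))"
    using y(1) span_is_monotone[OF S1(1)] by auto
  then have "y \<in> col_space A" by (simp add: col_space_def)
  then obtain x where x: "x \<in> carrier_vec n" "A *\<^sub>v x = y" using col_space_eq[OF A] A by auto
  have "y \<bullet> y = y \<bullet> (A *\<^sub>v x)" using x by simp
  also have "\<dots> = (transpose_mat A *\<^sub>v y) \<bullet> x"
    using transpose_vec_mult_scalar[OF A x(1) y(1)] by simp
  also have "\<dots> = 0" using y x by simp
  finally show ?thesis using conjugate_square_eq_0_vec[of y m] y(1) by simp
qed

lemma int_rank_eq_rows_iff: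
  assumes M: "M \<in> carrier_mat r (Suc r)"
  shows "int_rank M = r \<longleftrightarrow> signed_minors M \<noteq> 0\<^sub>v (Suc r)"
proof
  have rM: "real_mat M \<in> carrier_mat r (Suc r)" using M by simp
  show "signed_minors M \<noteq> 0\<^sub>v (Suc r)" if r: "int_rank M = r"
  proof
    assume s0: "signed_minors M = 0\<^sub>v (Suc r)"
    have T: "transpose_mat M \<in> carrier_mat (Suc r) r" using M by simp
    have inj: "y = 0\<^sub>v r" if y: "y \<in> carrier_vec r" "transpose_mat M *\<^sub>v y = 0\<^sub>v (Suc r)" for y
    proof -
      have "transpose_mat (real_mat M) = real_mat (transpose_mat M)" by (rule eq_matI) auto
      then have "transpose_mat (real_mat M) *\<^sub>v real_vec y = 0\<^sub>v (Suc r)"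
        using real_mat_mult_vec[of y "transpose_mat M"] y M
        by (auto simp: real_vec_eq_0)
      moreover have "vec_space.rank r (real_mat M) = r" using r M by (simp add: int_rank_def)
      ultimately have "real_vec y = 0\<^sub>v r"
        using rank_eq_rows_imp_no_left_kernel[OF rM, of "real_vec y"] y(1) by simp
      then show ?thesis by (simp add: real_vec_eq_0)
    qed
    obtain I where I: "I \<subseteq> {..<Suc r}" "card I = r"
      "det (submatrix (transpose_mat M) I UNIV) \<noteq> 0"
      using injective_imp_nonzero_minor[OF T inj] by blast
    \<comment> \<open>an \<open>r\<close>-subset of the \<open>r + 1\<close> columns leaves out exactly one of them\<close>
    have fI: "finite I" using I(1) finite_subset by blast
    have "card ({..<Suc r} - I) = 1" using I card_Diff_subset[OF fI I(1)] by simp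
    then obtain i where i: "{..<Suc r} - I = {i}" by (auto simp: card_1_singleton_iff)
    have iI: "I = {..<Suc r} - {i}" using i I(1) by auto
    have ir: "i < Suc r" using i by auto
    have "submatrix (transpose_mat M) I UNIV =
      transpose_mat (mat r r (\<lambda>(a, b). M $$ (a, if b < i then b else Suc b)))"
    proof (rule eq_matI)
      fix a b assume "a < dim_row (transpose_mat (mat r r (\<lambda>(a, b). M $$ (a, if b < i then b else Suc b))))"
        "b < dim_col (transpose_mat (mat r r (\<lambda>(a, b). M $$ (a, if b < i then b else Suc b))))"
      then have ab: "a < r" "b < r" by auto
      have "pick I a = (if a < i then a else Suc a)"
        unfolding iI by (rule pick_all_but_one) (use ir ab in auto)
      moreover have "submatrix (transpose_mat M) I UNIV $$ (a, b) = transpose_mat M $$ (pick I a, b)"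
        by (rule submatrix_rows_index[OF T I(1)]) (use I ab in auto)
      ultimately show "submatrix (transpose_mat M) I UNIV $$ (a, b) =
        transpose_mat (mat r r (\<lambda>(a, b). M $$ (a, if b < i then b else Suc b))) $$ (a, b)"
        using ab M by auto
    qed (use submatrix_rows_carrier[OF T I(1)] I(2) in auto)
    moreover have "det (transpose_mat (mat r r (\<lambda>(a, b). M $$ (a, if b < i then b else Suc b))))
      = det (mat r r (\<lambda>(a, b). M $$ (a, if b < i then b else Suc b)))"
      by (rule det_transpose[of _ r]) simp
    moreover have "signed_minors M $ i = 0" using s0 ir by simp
    then have "det (mat r r (\<lambda>(a, b). M $$ (a, if b < i then b else Suc b))) = 0"
      using M ir by (simp add: signed_minors_def)
    ultimately show False using I(3) by simp
  qed
  show "int_rank M = r" if s0: "signed_minors M \<noteq> 0\<^sub>v (Suc r)"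
  proof -
    have "\<exists>i < Suc r. signed_minors M $ i \<noteq> 0"
    proof (rule ccontr)
      assume "\<not> ?thesis"
      then have "signed_minors M = 0\<^sub>v (Suc r)"
        by (intro eq_vecI) (use signed_minors_carrier[OF M] in auto)
      with s0 show False by simp
    qed
    then obtain i where i: "i < Suc r" "signed_minors M $ i \<noteq> 0" by blast
    let ?J = "{..<Suc r} - {i}"
    note U = submatrix_all_rows[OF M]
    have "det (submatrix M {..<r} ?J) \<noteq> 0"
      using i M submatrix_drop_col[OF M, of "{..<r}" i] U by (auto simp: signed_minors_def)
    then have "det (submatrix (real_mat M) {..<r} ?J) \<noteq> 0"
      unfolding real_submatrix of_int_hom.hom_det by simp
    from vec_space.rank_gt_minor[OF rM this]
    have "r \<le> vec_space.rank r (real_mat M)"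
      using i(1) card_index_set[of ?J "Suc r"] by auto
    with rank_le_rows[OF rM] M show ?thesis unfolding int_rank_def by simp
  qed
qed

section \<open>Greatest common divisors of minors\<close>

lemma submatrix_all_cols:
  assumes A: "A \<in> carrier_mat m n" and I: "I \<subseteq> {..<m}"
  shows "submatrix A I {..<n} = submatrix A I UNIV"
proof -
  have "pick {..<n} b = b" if "b < n" for b
  proof -
    have "{x \<in> {..<n}. x < b} = {..<b}" using that by auto
    then show ?thesis using pick_card_in_set[of b "{..<n}"] that by simp
  qed
  then show ?thesis
    by (intro eq_matI)
      (use A in \<open>auto simp: dim_submatrix submatrix_index card_index_set[OF I] pick_UNIV\<close>)
qed

lemma mat_gcd_tall:
  assumes A: "A \<in> carrier_mat m n" and nm: "n \<le> m"
  shows "mat_gcd A = Gcd ((\<lambda>I. det (submatrix A I UNIV)) ` {I. I \<subseteq> {..<m} \<and> card I = n})"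
proof -
  have J: "J \<subseteq> {..<n} \<and> card J = n \<longleftrightarrow> J = {..<n}" for J
    using card_subset_eq[of "{..<n}" J] by auto
  have "{det (submatrix A I J) | I J. I \<subseteq> {..<m} \<and> J \<subseteq> {..<n} \<and> card I = n \<and> card J = n}
      = (\<lambda>I. det (submatrix A I UNIV)) ` {I. I \<subseteq> {..<m} \<and> card I = n}"
  proof (intro Set.set_eqI iffI)
    fix x assume "x \<in> {det (submatrix A I J) | I J. I \<subseteq> {..<m} \<and> J \<subseteq> {..<n} \<and> card I = n \<and> card J = n}"
    then obtain I J where IJ: "x = det (submatrix A I J)" "I \<subseteq> {..<m}" "card I = n" "J = {..<n}"
      using J by blast
    then show "x \<in> (\<lambda>I. det (submatrix A I UNIV)) ` {I. I \<subseteq> {..<m} \<and> card I = n}"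
      using submatrix_all_cols[OF A IJ(2)] by auto
  next
    fix x assume "x \<in> (\<lambda>I. det (submatrix A I UNIV)) ` {I. I \<subseteq> {..<m} \<and> card I = n}"
    then obtain I where I: "x = det (submatrix A I UNIV)" "I \<subseteq> {..<m}" "card I = n" by blast
    then have "x = det (submatrix A I {..<n})" using submatrix_all_cols[OF A I(2)] by simp
    then show "x \<in> {det (submatrix A I J) | I J. I \<subseteq> {..<m} \<and> J \<subseteq> {..<n} \<and> card I = n \<and> card J = n}"
      using I J by blast
  qed
  then show ?thesis unfolding mat_gcd_def using A nm by (simp add: min_absorb2)
qed

lemma mat_gcd_wide:
  assumes M: "M \<in> carrier_mat r (Suc r)"
  shows "mat_gcd M = Gcd ((\<lambda>i. signed_minors M $ i) ` {..<Suc r})"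
proof -
  let ?D = "\<lambda>i. det (submatrix M {..<r} ({..<Suc r} - {i}))"
  have I: "I \<subseteq> {..<r} \<and> card I = r \<longleftrightarrow> I = {..<r}" for I :: "nat set"
    using card_subset_eq[of "{..<r}" I] by auto
  have J: "J \<subseteq> {..<Suc r} \<and> card J = r \<longleftrightarrow> (\<exists>i<Suc r. J = {..<Suc r} - {i})" for J :: "nat set"
  proof
    assume J: "J \<subseteq> {..<Suc r} \<and> card J = r"
    then have "finite J" using finite_subset by blast
    then have "card ({..<Suc r} - J) = 1" using J by (simp add: card_Diff_subset)
    then obtain i where "{..<Suc r} - J = {i}" by (auto simp: card_1_singleton_iff)
    then have "i < Suc r" "J = {..<Suc r} - {i}" using J by auto
    then show "\<exists>i<Suc r. J = {..<Suc r} - {i}" by blast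
  next
    assume "\<exists>i<Suc r. J = {..<Suc r} - {i}"
    then obtain i where "i < Suc r" and J: "J = {..<Suc r} - {i}" by blast
    then show "J \<subseteq> {..<Suc r} \<and> card J = r" unfolding J by simp
  qed
  have "{det (submatrix M I J) | I J. I \<subseteq> {..<r} \<and> J \<subseteq> {..<Suc r} \<and> card I = r \<and> card J = r}
      = ?D ` {..<Suc r}"
  proof (intro Set.set_eqI iffI)
    fix x assume "x \<in> {det (submatrix M I J) | I J. I \<subseteq> {..<r} \<and> J \<subseteq> {..<Suc r} \<and> card I = r \<and> card J = r}"
    then obtain K L where KL: "x = det (submatrix M K L)" "K \<subseteq> {..<r}" "card K = r"
      "L \<subseteq> {..<Suc r}" "card L = r" by blast
    have K: "K = {..<r}" using I[of K] KL(2,3) by blast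
    obtain i where "i < Suc r" "L = {..<Suc r} - {i}" using J[of L] KL(4,5) by blast
    then show "x \<in> ?D ` {..<Suc r}" unfolding KL(1) K by (intro image_eqI[of _ _ i]) auto
  next
    fix x assume "x \<in> ?D ` {..<Suc r}"
    then obtain i where i: "i < Suc r" "x = ?D i" by auto
    define L where "L = {..<Suc r} - {i}"
    have L: "L \<subseteq> {..<Suc r}" "card L = r" using J[of L] i(1) by (auto simp: L_def)
    have x: "x = det (submatrix M {..<r} L)" using i(2) by (simp add: L_def)
    then show "x \<in> {det (submatrix M I J) | I J. I \<subseteq> {..<r} \<and> J \<subseteq> {..<Suc r} \<and> card I = r \<and> card J = r}"
      unfolding mem_Collect_eq
      by (intro exI[of _ "{..<r}"] exI[of _ L]) (use x L in auto)
  qed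
  then have "mat_gcd M = Gcd (?D ` {..<Suc r})"
    unfolding mat_gcd_def using M by (simp add: min_absorb1 conj_ac)
  also have "\<dots> = Gcd (normalize ` ?D ` {..<Suc r})" by (rule Gcd_image_normalize[symmetric])
  also have "normalize ` ?D ` {..<Suc r} = normalize ` (\<lambda>i. signed_minors M $ i) ` {..<Suc r}"
    unfolding image_image
  proof (rule image_cong)
    fix i assume "i \<in> {..<Suc r}"
    then have i: "i < Suc r" by simp
    have "signed_minors M $ i = (-1) ^ (i + 1) * ?D i"
      using M i submatrix_drop_col[OF M, of "{..<r}" i] submatrix_all_rows[OF M]
      by (simp add: signed_minors_def)
    then show "normalize (?D i) = normalize (signed_minors M $ i)"
      by (simp add: abs_mult)
  qed simp
  also have "Gcd \<dots> = Gcd ((\<lambda>i. signed_minors M $ i) ` {..<Suc r})" by (rule Gcd_image_normalize)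
  finally show ?thesis .
qed

lemma submatrix_mult:
  assumes A: "A \<in> carrier_mat m n" and B: "B \<in> carrier_mat n n" and I: "I \<subseteq> {..<m}"
  shows "submatrix (A * B) I UNIV = submatrix A I UNIV * B"
proof (rule eq_matI)
  have AB: "A * B \<in> carrier_mat m n" using A B by simp
  note S = submatrix_rows_carrier[OF A I]
  show "dim_row (submatrix (A * B) I UNIV) = dim_row (submatrix A I UNIV * B)"
    "dim_col (submatrix (A * B) I UNIV) = dim_col (submatrix A I UNIV * B)"
    using submatrix_rows_carrier[OF AB I] S B by auto
  fix i j assume "i < dim_row (submatrix A I UNIV * B)" "j < dim_col (submatrix A I UNIV * B)"
  then have ij: "i < card I" "j < n" using S B by auto
  have "row A (pick I i) = row (submatrix A I UNIV) i"
    by (rule eq_vecI)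
      (use A S ij pick_index_set[OF I ij(1)] in \<open>auto simp: submatrix_rows_index[OF A I]\<close>)
  then show "submatrix (A * B) I UNIV $$ (i, j) = (submatrix A I UNIV * B) $$ (i, j)"
    using submatrix_rows_index[OF AB I ij] A B S ij pick_index_set[OF I ij(1)] by simp
qed

lemma mat_gcd_mult:
  assumes A: "A \<in> carrier_mat m n" and B: "B \<in> carrier_mat n n" and nm: "n \<le> m"
  shows "mat_gcd (A * B) = \<bar>det B\<bar> * mat_gcd A"
proof -
  let ?S = "{I. I \<subseteq> {..<m} \<and> card I = n}"
  have AB: "A * B \<in> carrier_mat m n" using A B by simp
  have "(\<lambda>I. det (submatrix (A * B) I UNIV)) ` ?S
      = (*) (det B) ` (\<lambda>I. det (submatrix A I UNIV)) ` ?S"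
    unfolding image_image
  proof (rule image_cong)
    fix I assume "I \<in> ?S"
    then have I: "I \<subseteq> {..<m}" "card I = n" by auto
    have "submatrix A I UNIV \<in> carrier_mat n n" using submatrix_rows_carrier[OF A I(1)] I(2) by simp
    then show "det (submatrix (A * B) I UNIV) = det B * det (submatrix A I UNIV)"
      using submatrix_mult[OF A B I(1)] det_mult[OF _ B] by simp
  qed simp
  then show ?thesis
    unfolding mat_gcd_tall[OF A nm] mat_gcd_tall[OF AB nm] by (simp add: Gcd_mult abs_mult)
qed

lemma mat_gcd_wide_proportional:
  assumes M: "M \<in> carrier_mat r (Suc r)" and M': "M' \<in> carrier_mat r (Suc r)"
    and ab: "a \<cdot>\<^sub>v signed_minors M = b \<cdot>\<^sub>v signed_minors M'"
  shows "\<bar>a\<bar> * mat_gcd M = \<bar>b\<bar> * mat_gcd M'"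
proof -
  have *: "\<bar>c\<bar> * mat_gcd N = Gcd ((\<lambda>i. (c \<cdot>\<^sub>v signed_minors N) $ i) ` {..<Suc r})"
    if N: "N \<in> carrier_mat r (Suc r)" for c N
  proof -
    have "(\<lambda>i. (c \<cdot>\<^sub>v signed_minors N) $ i) ` {..<Suc r}
        = (*) c ` (\<lambda>i. signed_minors N $ i) ` {..<Suc r}"
      unfolding image_image
      by (rule image_cong) (use signed_minors_carrier[OF N] in auto)
    then show ?thesis unfolding mat_gcd_wide[OF N] by (simp add: Gcd_mult abs_mult del: image_image)
  qed
  show ?thesis unfolding *[OF M] *[OF M'] ab ..
qed

lemma mult_mat_vec_smult:
  fixes A :: "'a :: comm_semiring_0 mat"
  assumes "A \<in> carrier_mat m n" "v \<in> carrier_vec n"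
  shows "A *\<^sub>v (c \<cdot>\<^sub>v v) = c \<cdot>\<^sub>v (A *\<^sub>v v)"
  by (rule eq_vecI) (use assms in auto)

text \<open>
  Proportional vectors of signed minors stay proportional, with the same factor, when the matrices are
  multiplied by \<open>B\<close>. The gcds scale with that factor, so their order is preserved; this is what keeps an
  index set maximizing on a ray.
\<close>

lemma mat_gcd_le_mult:
  assumes M: "M \<in> carrier_mat r (Suc r)" and M': "M' \<in> carrier_mat r (Suc r)"
    and B: "B \<in> carrier_mat (Suc r) (Suc r)" and dB: "det B \<noteq> 0"
    and s0: "signed_minors M \<noteq> 0\<^sub>v (Suc r)"
    and par: "real_vec (signed_minors M') = t \<cdot>\<^sub>v real_vec (signed_minors M)"
    and le: "mat_gcd M' \<le> mat_gcd M"
  shows "mat_gcd (M' * B) \<le> mat_gcd (M * B)"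
proof -
  let ?n = "Suc r"
  let ?s = "signed_minors M" and ?s' = "signed_minors M'"
  have c: "?s \<in> carrier_vec ?n" "?s' \<in> carrier_vec ?n"
    using signed_minors_carrier[OF M] signed_minors_carrier[OF M'] by auto
  have MB: "M * B \<in> carrier_mat r ?n" "M' * B \<in> carrier_mat r ?n" using M M' B by auto
  obtain k where k: "k < ?n" "?s $ k \<noteq> 0"
  proof (rule ccontr)
    assume "\<not> thesis"
    then have "\<And>k. k < ?n \<Longrightarrow> ?s $ k = 0" using that by blast
    then have "?s = 0\<^sub>v ?n" by (intro eq_vecI) (use c in auto)
    with s0 show False by simp
  qed
  \<comment> \<open>corresponding entries of the two vectors replace the real factor \<open>t\<close> by a fraction of integers\<close>
  define a where "a = ?s $ k"
  define b where "b = ?s' $ k"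
  have tj: "real_of_int (?s' $ j) = t * real_of_int (?s $ j)" if "j < ?n" for j
    using arg_cong[OF par, of "\<lambda>v. v $ j"] that c by auto
  have ab: "a \<cdot>\<^sub>v ?s' = b \<cdot>\<^sub>v ?s"
  proof (rule eq_vecI)
    fix j assume "j < dim_vec (b \<cdot>\<^sub>v ?s)"
    then have j: "j < ?n" using c by simp
    have "real_of_int (a * ?s' $ j) = real_of_int (b * ?s $ j)"
      unfolding a_def b_def of_int_mult tj[OF j] tj[OF k(1)] by simp
    then show "(a \<cdot>\<^sub>v ?s') $ j = (b \<cdot>\<^sub>v ?s) $ j" using j c by (simp only: of_int_eq_iff) simp
  qed (use c in auto)
  have ab': "a \<cdot>\<^sub>v signed_minors (M' * B) = b \<cdot>\<^sub>v signed_minors (M * B)"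
  proof -
    let ?u = "signed_minors (M * B)" and ?u' = "signed_minors (M' * B)"
    have u: "?u \<in> carrier_vec ?n" "?u' \<in> carrier_vec ?n"
      using signed_minors_carrier MB by auto
    have "B *\<^sub>v (a \<cdot>\<^sub>v ?u' - b \<cdot>\<^sub>v ?u) = a \<cdot>\<^sub>v (B *\<^sub>v ?u') - b \<cdot>\<^sub>v (B *\<^sub>v ?u)"
      using u by (subst mult_minus_distrib_mat_vec[OF B]) (auto simp: mult_mat_vec_smult[OF B])
    also have "\<dots> = det B \<cdot>\<^sub>v (a \<cdot>\<^sub>v ?s') - det B \<cdot>\<^sub>v (b \<cdot>\<^sub>v ?s)"
      unfolding mult_signed_minors_mult[OF M B] mult_signed_minors_mult[OF M' B]
      by (simp add: smult_smult_assoc mult.commute)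
    also have "\<dots> = 0\<^sub>v ?n" unfolding ab using c by simp
    finally have "a \<cdot>\<^sub>v ?u' - b \<cdot>\<^sub>v ?u = 0\<^sub>v ?n"
      using det_0_iff_vec_prod_zero[OF B] dB u
      by (metis minus_carrier_vec smult_carrier_vec)
    then have "(a \<cdot>\<^sub>v ?u' - b \<cdot>\<^sub>v ?u) $ j = 0" if "j < ?n" for j using that by simp
    then show ?thesis by (intro eq_vecI) (use u in auto)
  qed
  have e: "\<bar>a\<bar> * mat_gcd M' = \<bar>b\<bar> * mat_gcd M" by (rule mat_gcd_wide_proportional[OF M' M ab])
  have e': "\<bar>a\<bar> * mat_gcd (M' * B) = \<bar>b\<bar> * mat_gcd (M * B)"
    by (rule mat_gcd_wide_proportional[OF MB(2,1) ab'])
  have "mat_gcd M dvd ?s $ k" unfolding mat_gcd_wide[OF M] using k(1) by (intro Gcd_dvd) auto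
  then have "mat_gcd M \<noteq> 0" using k(2) by auto
  moreover have "mat_gcd M \<ge> 0" "mat_gcd (M * B) \<ge> 0"
    unfolding mat_gcd_wide[OF M] mat_gcd_wide[OF MB(1)] by simp_all
  ultimately have pos: "mat_gcd M > 0" "mat_gcd (M * B) \<ge> 0" by auto
  have "\<bar>b\<bar> * mat_gcd M \<le> \<bar>a\<bar> * mat_gcd M" unfolding e[symmetric] using le by (simp add: mult_left_mono)
  then have "\<bar>b\<bar> \<le> \<bar>a\<bar>" using pos(1) by simp
  then have "\<bar>a\<bar> * mat_gcd (M' * B) \<le> \<bar>a\<bar> * mat_gcd (M * B)"
    unfolding e' using pos(2) by (simp add: mult_right_mono)
  then show ?thesis using k(2) by (simp add: a_def)
qed

section \<open>Splitting off a prime factor\<close>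

text \<open>
  The unit matrix with column \<open>j\<close> replaced by a column that has \<open>p\<close> in row \<open>j\<close> and \<open>- v $ i\<close> in the other
  rows \<open>i\<close>. It is the product of the diagonal matrix with a single \<open>p\<close> and the inverse of the unit matrix
  with column \<open>j\<close> replaced by \<open>v\<close>, provided that \<open>v $ j = 1\<close>.
\<close>

definition prime_step :: "nat \<Rightarrow> nat \<Rightarrow> int \<Rightarrow> int vec \<Rightarrow> int mat" where
  "prime_step n j p v = mat n n (\<lambda>(i, k).
     if i = k then (if i = j then p else 1) else if k = j then - v $ i else 0)"

lemma prime_step_carrier: "prime_step n j p v \<in> carrier_mat n n"
  by (simp add: prime_step_def)

lemma det_prime_step:
  assumes j: "j < n"
  shows "det (prime_step n j p v) = p"
proof -
  let ?E = "prime_step n j p v"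
  have "det ?E = (\<Sum>k<n. ?E $$ (j, k) * cofactor ?E j k)"
    by (rule laplace_expansion_row[OF prime_step_carrier j])
  also have "\<dots> = (\<Sum>k<n. if k = j then p * cofactor ?E j j else 0)"
    by (rule sum.cong) (auto simp: prime_step_def j)
  also have "\<dots> = p * cofactor ?E j j" using j by simp
  also have "mat_delete ?E j j = 1\<^sub>m (n - 1)"
    by (rule eq_matI) (use j in \<open>auto simp: mat_delete_def prime_step_def\<close>)
  then have "cofactor ?E j j = 1" by (simp add: cofactor_def)
  finally show ?thesis by simp
qed

lemma prime_step_mult_vec:
  assumes j: "j < n" and y: "y \<in> carrier_vec n" and i: "i < n"
  shows "(prime_step n j p v *\<^sub>v y) $ i = (if i = j then p * y $ j else y $ i - v $ i * y $ j)"
proof -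
  have "(prime_step n j p v *\<^sub>v y) $ i = (\<Sum>k<n. prime_step n j p v $$ (i, k) * y $ k)"
    using i y by (auto simp: prime_step_def scalar_prod_def atLeast0LessThan intro!: sum.cong)
  also have "\<dots> =
      (\<Sum>k<n. (if k = i then (if i = j then p else 1) * y $ i else 0) +
             (if k = j then (if i = j then 0 else - v $ i * y $ j) else 0))"
    by (rule sum.cong) (use i in \<open>auto simp: prime_step_def\<close>)
  also have "\<dots> = (if i = j then p else 1) * y $ i + (if i = j then 0 else - v $ i * y $ j)"
    using i j by (simp add: sum.distrib)
  finally show ?thesis by auto
qed

lemma prime_step_image:
  assumes j: "j < n" and z: "z \<in> carrier_vec n" and p: "p dvd z $ j" "p \<noteq> 0"
  shows "\<exists>y \<in> carrier_vec n. z = prime_step n j p v *\<^sub>v y"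
proof
  define q where "q = z $ j div p"
  have q: "p * q = z $ j" using p by (simp add: q_def)
  let ?y = "vec n (\<lambda>i. if i = j then q else z $ i + v $ i * q)"
  show y: "?y \<in> carrier_vec n" by simp
  show "z = prime_step n j p v *\<^sub>v ?y"
  proof (rule eq_vecI)
    fix i assume "i < dim_vec (prime_step n j p v *\<^sub>v ?y)"
    then have i: "i < n" by (simp add: prime_step_def)
    show "z $ i = (prime_step n j p v *\<^sub>v ?y) $ i"
      unfolding prime_step_mult_vec[OF j y i] using i j q by simp
  qed (use z in \<open>simp add: prime_step_def\<close>)
qed

text \<open>
  Take a kernel vector modulo \<open>p\<close> and scale it modulo \<open>p\<close> to a vector \<open>v\<close> with \<open>v $ j = 1\<close>. Replacing column
  \<open>j\<close> of \<open>A\<close> by \<open>A v\<close> is a unimodular column operation, and the new column is divisible by \<open>p\<close>. The matrix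
  \<open>A'\<close> arises by dividing it by \<open>p\<close>.
\<close>

lemma extract_prime_step:
  assumes A: "A \<in> carrier_mat m n" and p: "prime p"
    and minors: "\<And>I. I \<subseteq> {..<m} \<Longrightarrow> card I = n \<Longrightarrow> p dvd det (submatrix A I UNIV)"
  obtains A' j v where "A' \<in> carrier_mat m n" "j < n" "A = A' * prime_step n j p v"
proof -
  have "\<not> p dvd 1" using p not_prime_unit by blast
  then obtain w j where w: "w \<in> carrier_vec n" "j < n" "\<not> p dvd w $ j"
    "\<And>i. i < m \<Longrightarrow> p dvd (A *\<^sub>v w) $ i"
    using row_minors_dvd_imp_kernel_vector[OF A _ minors] by blast
  have "coprime (w $ j) p" using p w(3) by (simp add: prime_imp_coprime coprime_commute)
  then obtain c where c: "[w $ j * c = 1] (mod p)" using cong_solve_coprime_int by blast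
  define v where "v = vec n (\<lambda>i. if i = j then 1 else c * w $ i)"
  have dv: "p dvd (\<Sum>k<n. A $$ (i, k) * v $ k)" if i: "i < m" for i
  proof -
    have "(\<Sum>k<n. A $$ (i, k) * v $ k) =
        (\<Sum>k<n. c * (A $$ (i, k) * w $ k) - (if k = j then A $$ (i, j) * (w $ j * c - 1) else 0))"
      by (rule sum.cong) (auto simp: v_def algebra_simps)
    also have "\<dots> = c * (\<Sum>k<n. A $$ (i, k) * w $ k) - A $$ (i, j) * (w $ j * c - 1)"
      using w(2) by (simp add: sum_subtractf sum_distrib_left)
    also have "(\<Sum>k<n. A $$ (i, k) * w $ k) = (A *\<^sub>v w) $ i"
      using A w(1) i by (auto simp: scalar_prod_def atLeast0LessThan intro!: sum.cong)
    finally show ?thesis using w(4)[OF i] c by (simp add: cong_iff_dvd_diff)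
  qed
  define A' where "A' = mat m n (\<lambda>(i, k).
    if k = j then (\<Sum>k<n. A $$ (i, k) * v $ k) div p else A $$ (i, k))"
  have A': "A' \<in> carrier_mat m n" by (simp add: A'_def)
  have "A = A' * prime_step n j p v"
  proof (rule eq_matI)
    fix i l assume "i < dim_row (A' * prime_step n j p v)" "l < dim_col (A' * prime_step n j p v)"
    then have i: "i < m" and l: "l < n" by (auto simp: A'_def prime_step_def)
    have "(A' * prime_step n j p v) $$ (i, l) = (\<Sum>k<n. A' $$ (i, k) * prime_step n j p v $$ (k, l))"
      using i l by (auto simp: A'_def prime_step_def scalar_prod_def atLeast0LessThan intro!: sum.cong)
    also have "\<dots> = A $$ (i, l)"
    proof (cases "l = j")
      case False
      then have "(\<Sum>k<n. A' $$ (i, k) * prime_step n j p v $$ (k, l))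
          = (\<Sum>k<n. if k = l then A $$ (i, l) else 0)"
        by (intro sum.cong) (use i l in \<open>auto simp: A'_def prime_step_def\<close>)
      then show ?thesis using l by simp
    next
      case True
      have "(\<Sum>k<n. A' $$ (i, k) * prime_step n j p v $$ (k, l))
          = (\<Sum>k<n. (if k = j then p * ((\<Sum>k<n. A $$ (i, k) * v $ k) div p) + A $$ (i, j) else 0)
               - A $$ (i, k) * v $ k)"
        by (intro sum.cong) (use i l True in \<open>auto simp: A'_def prime_step_def v_def\<close>)
      also have "\<dots> = A $$ (i, j)" using w(2) dv[OF i] by (simp add: sum_subtractf)
      finally show ?thesis using True by simp
    qed
    finally show "A $$ (i, l) = (A' * prime_step n j p v) $$ (i, l)" by simp
  qed (use A in \<open>auto simp: A'_def prime_step_def\<close>)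
  with A' w(2) show ?thesis using that by blast
qed

section \<open>Cones, faces and extreme rays\<close>

text \<open>
  The set \<open>W\<close> may be infinite; a maximal independent subset of it is finite and has the same span.
\<close>

lemma dim_span_eq_1_iff:
  fixes W :: "real vec set"
  assumes W: "W \<subseteq> carrier_vec n"
  shows "vectorspace.dim class_ring (module.span_vs class_ring (module_vec TYPE(real) n) W) = 1 \<longleftrightarrow>
    (\<exists>w \<in> W. w \<noteq> 0\<^sub>v n \<and> (\<forall>x \<in> W. \<exists>t. x = t \<cdot>\<^sub>v w))"
proof -
  interpret vec_space "TYPE(real)" n .
  have indpt_single: "lin_indpt {w}" if w: "w \<in> carrier_vec n" "w \<noteq> 0\<^sub>v n" for w
  proof -
    have "lin_indpt {}" by (rule finite_lin_indpt2) auto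
    then show ?thesis using lin_dep_iff_in_span[of "{}" w] w span_empty by auto
  qed
  have in_span_single: "\<exists>t. x = t \<cdot>\<^sub>v w" if w: "w \<in> carrier_vec n" and x: "x \<in> span {w}" for x w
  proof -
    obtain a where "x = lincomb a {w}" using finite_in_span[of "{w}" x] w x by auto
    then have "x = a w \<cdot>\<^sub>v w" using w
      by (intro eq_vecI) (auto simp: lincomb_index lincomb_dim)
    then show ?thesis by blast
  qed
  have single_in_span: "t \<cdot>\<^sub>v w \<in> span {w}" if w: "w \<in> carrier_vec n" for t w
  proof -
    have "w \<in> span {w}" using in_own_span[of "{w}"] w by auto
    then show ?thesis using smult_in_span[of "{w}" w t] w by auto
  qed
  have dim_single: "vectorspace.dim class_ring (span_vs {w}) = 1"
    if w: "w \<in> carrier_vec n" "w \<noteq> 0\<^sub>v n" for w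
  proof -
    have "maximal {w} (\<lambda>T. T \<subseteq> {w} \<and> lin_indpt T)"
      using indpt_single[OF w] by (auto simp: maximal_def)
    then show ?thesis using dim_span[of "{w}" "{w}"] w by simp
  qed
  show ?thesis
  proof
    assume "\<exists>w \<in> W. w \<noteq> 0\<^sub>v n \<and> (\<forall>x \<in> W. \<exists>t. x = t \<cdot>\<^sub>v w)"
    then obtain w where w: "w \<in> W" "w \<noteq> 0\<^sub>v n" "\<And>x. x \<in> W \<Longrightarrow> \<exists>t. x = t \<cdot>\<^sub>v w" by blast
    then have wc: "w \<in> carrier_vec n" using W by blast
    have "W \<subseteq> span {w}"
    proof
      fix x assume "x \<in> W"
      then obtain t where "x = t \<cdot>\<^sub>v w" using w(3) by blast
      then show "x \<in> span {w}" using single_in_span[OF wc] by simp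
    qed
    then have "span W \<subseteq> span {w}" using span_is_subset span_is_submodule wc by simp
    moreover have "span {w} \<subseteq> span W" by (rule span_is_monotone) (use w in auto)
    ultimately have "span W = span {w}" by blast
    then show "vectorspace.dim class_ring (span_vs W) = 1" using dim_single[OF wc w(2)] by simp
  next
    assume d: "vectorspace.dim class_ring (span_vs W) = 1"
    have e: "lin_indpt {}" by (rule finite_lin_indpt2) auto
    have "\<exists>U. finite U \<and> maximal U (\<lambda>T. T \<subseteq> W \<and> lin_indpt T)"
      by (rule maximal_exists[of _ dim "{}"])
        (use W li_le_dim[OF fin_dim] e in auto)
    then obtain U where U: "finite U" "maximal U (\<lambda>T. T \<subseteq> W \<and> lin_indpt T)" by blast
    then have U1: "U \<subseteq> W" "lin_indpt U" by (auto simp: maximal_def)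
    have Uc: "U \<subseteq> carrier_vec n" using U1 W by blast
    have WU: "W \<subseteq> span U"
    proof
      fix x assume x: "x \<in> W"
      show "x \<in> span U"
      proof (rule ccontr)
        assume nx: "x \<notin> span U"
        then have xU: "x \<notin> U" using in_own_span[of U] Uc by auto
        have "lin_indpt (U \<union> {x})"
          using lin_dep_iff_in_span[of U x] Uc U1(2) xU x W nx by auto
        then have "U \<union> {x} = U" using U(2) U1(1) x unfolding maximal_def by blast
        with xU show False by blast
      qed
    qed
    have "span W \<subseteq> span U" using WU span_is_subset span_is_submodule Uc by simp
    moreover have "span U \<subseteq> span W" by (rule span_is_monotone[OF U1(1)])
    ultimately have "span W = span U" by blast
    moreover have "vectorspace.dim class_ring (span_vs U) = card U"
      by (rule dim_span) (use Uc U(1) U1 in \<open>auto simp: maximal_def\<close>)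
    ultimately have "card U = 1" using d by simp
    then obtain w where Uw: "U = {w}" by (auto simp: card_1_singleton_iff)
    then have wc: "w \<in> carrier_vec n" "w \<in> W" using U1(1) W by auto
    have "w \<noteq> 0\<^sub>v n"
    proof
      assume "w = 0\<^sub>v n"
      then have "0\<^sub>v n \<in> U" using Uw by simp
      moreover have "(UNIV :: real set) \<noteq> {0}" by (metis UNIV_I singletonD zero_neq_one)
      ultimately have "lin_dep U" using zero_lin_dep[of U] by simp
      with U1(2) show False by simp
    qed
    moreover have "\<forall>x \<in> W. \<exists>t. x = t \<cdot>\<^sub>v w"
      using WU in_span_single[OF wc(1)] unfolding Uw by blast
    ultimately show "\<exists>w \<in> W. w \<noteq> 0\<^sub>v n \<and> (\<forall>x \<in> W. \<exists>t. x = t \<cdot>\<^sub>v w)" using wc(2) by blast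
  qed
qed

lemma real_mat_mult:
  "A \<in> carrier_mat m n \<Longrightarrow> B \<in> carrier_mat n k \<Longrightarrow> real_mat (A * B) = real_mat A * real_mat B"
  by (rule of_int_hom.mat_hom_mult)

lemma cone_of_iff:
  assumes "A \<in> carrier_mat m n"
  shows "x \<in> cone_of A \<longleftrightarrow> x \<in> carrier_vec n \<and> (\<forall>i<m. 0 \<le> (real_mat A *\<^sub>v x) $ i)"
  using assms by (auto simp: cone_of_def less_eq_vec_def)

lemma cone_of_mult:
  assumes A: "A \<in> carrier_mat m n" and B: "B \<in> carrier_mat n n"
  shows "x \<in> cone_of (A * B) \<longleftrightarrow> x \<in> carrier_vec n \<and> real_mat B *\<^sub>v x \<in> cone_of A"
proof -
  have AB: "A * B \<in> carrier_mat m n" using A B by simp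
  have "real_mat (A * B) *\<^sub>v x = real_mat A *\<^sub>v (real_mat B *\<^sub>v x)" if "x \<in> carrier_vec n"
    unfolding real_mat_mult[OF A B]
    by (rule assoc_mult_mat_vec[of _ m n _ n]) (use A B that in auto)
  then show ?thesis unfolding cone_of_iff[OF A] cone_of_iff[OF AB] using B by auto
qed

lemma real_inverse:
  assumes B: "B \<in> carrier_mat n n" and dB: "det B \<noteq> 0"
  obtains C where "C \<in> carrier_mat n n"
    "\<And>x. x \<in> carrier_vec n \<Longrightarrow> C *\<^sub>v (real_mat B *\<^sub>v x) = x"
    "\<And>x. x \<in> carrier_vec n \<Longrightarrow> real_mat B *\<^sub>v (C *\<^sub>v x) = x"
proof -
  let ?R = "real_mat B"
  have R: "?R \<in> carrier_mat n n" using B by simp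
  have d: "det ?R \<noteq> 0" using dB by simp
  let ?C = "(1 / det ?R) \<cdot>\<^sub>m adj_mat ?R"
  have C: "?C \<in> carrier_mat n n" using adj_mat(1)[OF R] by simp
  have "?R * ?C = (1 / det ?R) \<cdot>\<^sub>m (?R * adj_mat ?R)"
    by (rule mult_smult_distrib[OF R adj_mat(1)[OF R]])
  also have "\<dots> = 1\<^sub>m n" unfolding adj_mat(2)[OF R] using d by (intro eq_matI) auto
  finally have RC: "?R * ?C = 1\<^sub>m n" .
  show ?thesis
  proof (rule that[OF C])
    fix x :: "real vec" assume x: "x \<in> carrier_vec n"
    show "?C *\<^sub>v (?R *\<^sub>v x) = x"
      unfolding assoc_mult_mat_vec[OF C R x, symmetric] mat_mult_left_right_inverse[OF R C RC]
      using x by simp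
    show "?R *\<^sub>v (?C *\<^sub>v x) = x"
      unfolding assoc_mult_mat_vec[OF R C x, symmetric] RC using x by simp
  qed
qed

text \<open>
  The constant in the inequality defining a nonempty face of a cone is 0, so the face is a cone itself.
\<close>

lemma faceD:
  assumes A: "A \<in> carrier_mat m n" and F: "is_face n (cone_of A) F"
  shows "F \<subseteq> cone_of A"
    and "\<And>x t. x \<in> F \<Longrightarrow> 0 \<le> t \<Longrightarrow> t \<cdot>\<^sub>v x \<in> F"
proof -
  from F obtain c \<delta> where c: "c \<in> carrier_vec n" and v: "\<And>x. x \<in> cone_of A \<Longrightarrow> \<delta> \<le> c \<bullet> x"
    and Fe: "F = {x \<in> cone_of A. c \<bullet> x = \<delta>}" and ne: "F \<noteq> {}"
    unfolding is_face_def by blast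
  show "F \<subseteq> cone_of A" using Fe by blast
  have scale: "t \<cdot>\<^sub>v x \<in> cone_of A" if x: "x \<in> cone_of A" and t: "0 \<le> t" for x t
  proof -
    have rA: "real_mat A \<in> carrier_mat m n" using A by simp
    have xc: "x \<in> carrier_vec n" using x cone_of_iff[OF A] by blast
    have "(real_mat A *\<^sub>v (t \<cdot>\<^sub>v x)) $ i = t * (real_mat A *\<^sub>v x) $ i" if "i < m" for i
      unfolding mult_mat_vec_smult[OF rA xc] using that A by simp
    then show ?thesis using x t unfolding cone_of_iff[OF A] by simp
  qed
  obtain x0 where x0: "x0 \<in> F" using ne by blast
  then have x0c: "x0 \<in> cone_of A" "c \<bullet> x0 = \<delta>" "x0 \<in> carrier_vec n"
    using Fe cone_of_iff[OF A] by auto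
  \<comment> \<open>the multiples 0 and 2 of a point of the face show that the constant is 0\<close>
  have "\<delta> \<le> c \<bullet> (0 \<cdot>\<^sub>v x0)" "\<delta> \<le> c \<bullet> (2 \<cdot>\<^sub>v x0)" by (rule v, rule scale[OF x0c(1)], simp)+
  then have d0: "\<delta> = 0" using c x0c(2,3) by simp
  show "t \<cdot>\<^sub>v x \<in> F" if x: "x \<in> F" and t: "0 \<le> t" for x t
  proof -
    have "x \<in> cone_of A" "c \<bullet> x = 0" using x Fe d0 by auto
    moreover from this have "x \<in> carrier_vec n" using cone_of_iff[OF A] by auto
    ultimately show ?thesis using c scale[of x t] t Fe d0 by simp
  qed
qed

lemma affine_dim_eq_1_iff:
  fixes F :: "real vec set"
  assumes "F \<subseteq> carrier_vec n"
  shows "vec_space.affine_dim n F = 1 \<longleftrightarrow>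
    (\<exists>x \<in> F. \<exists>y \<in> F. x - y \<noteq> 0\<^sub>v n \<and> (\<forall>x' \<in> F. \<forall>y' \<in> F. \<exists>t. x' - y' = t \<cdot>\<^sub>v (x - y)))"
proof -
  have W: "{x - y | x y. x \<in> F \<and> y \<in> F} \<subseteq> carrier_vec n"
    using assms minus_carrier_vec by blast
  show ?thesis unfolding vec_space.affine_dim_def dim_span_eq_1_iff[OF W] by blast
qed

section \<open>Normalized generators and multiplication by a square matrix\<close>

definition ray_preimage :: "int mat \<Rightarrow> real vec set \<Rightarrow> real vec set" where
  "ray_preimage B F = {x \<in> carrier_vec (dim_col B). real_mat B *\<^sub>v x \<in> F}"

text \<open>
  The normal vector of the face is pulled back by the transpose of \<open>B\<close>, and the dimension is transported by
  the inverse of \<open>B\<close>.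
\<close>

lemma extreme_ray_preimage:
  assumes A: "A \<in> carrier_mat m n" and B: "B \<in> carrier_mat n n" and dB: "det B \<noteq> 0"
    and F: "extreme_ray A F"
  shows "extreme_ray (A * B) (ray_preimage B F)"
proof -
  let ?G = "ray_preimage B F"
  let ?R = "real_mat B"
  have R: "?R \<in> carrier_mat n n" using B by simp
  obtain C where C: "C \<in> carrier_mat n n"
    and CR: "\<And>x. x \<in> carrier_vec n \<Longrightarrow> C *\<^sub>v (real_mat B *\<^sub>v x) = x"
    and RC: "\<And>x. x \<in> carrier_vec n \<Longrightarrow> real_mat B *\<^sub>v (C *\<^sub>v x) = x"
    using real_inverse[OF B dB] by blast
  have face: "is_face n (cone_of A) F" and dim: "vec_space.affine_dim n F = 1"
    using F A by (auto simp: extreme_ray_def)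
  have Fc: "F \<subseteq> carrier_vec n" using faceD(1)[OF A face] cone_of_iff[OF A] by auto
  have G: "x \<in> ?G \<longleftrightarrow> x \<in> carrier_vec n \<and> ?R *\<^sub>v x \<in> F" for x
    using B by (auto simp: ray_preimage_def)
  have CG: "C *\<^sub>v y \<in> ?G" if "y \<in> F" for y using that RC Fc C unfolding G by auto
  from face obtain c \<delta> where c: "c \<in> carrier_vec n" and v: "\<And>x. x \<in> cone_of A \<Longrightarrow> \<delta> \<le> c \<bullet> x"
    and Fe: "F = {x \<in> cone_of A. c \<bullet> x = \<delta>}" and ne: "F \<noteq> {}"
    unfolding is_face_def by blast
  have "is_face n (cone_of (A * B)) ?G" unfolding is_face_def
  proof (intro conjI bexI exI)
    show "?G \<noteq> {}" using ne CG by blast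
    have e: "(transpose_mat ?R *\<^sub>v c) \<bullet> x = c \<bullet> (?R *\<^sub>v x)" if "x \<in> carrier_vec n" for x
      by (rule transpose_vec_mult_scalar[OF R that c])
    show "\<forall>x\<in>cone_of (A * B). \<delta> \<le> (transpose_mat ?R *\<^sub>v c) \<bullet> x"
      using v e cone_of_mult[OF A B] by auto
    show "?G = {x \<in> cone_of (A * B). (transpose_mat ?R *\<^sub>v c) \<bullet> x = \<delta>}"
    proof (rule Set.set_eqI)
      fix x
      have "?R *\<^sub>v x \<in> F \<longleftrightarrow> ?R *\<^sub>v x \<in> cone_of A \<and> c \<bullet> (?R *\<^sub>v x) = \<delta>" using Fe by blast
      then show "x \<in> ?G \<longleftrightarrow> x \<in> {x \<in> cone_of (A * B). (transpose_mat ?R *\<^sub>v c) \<bullet> x = \<delta>}"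
        unfolding G mem_Collect_eq cone_of_mult[OF A B] using e[of x] by auto
    qed
    show "transpose_mat ?R *\<^sub>v c \<in> carrier_vec n" using R c by simp
  qed
  moreover have "vec_space.affine_dim n ?G = 1"
  proof -
    have Gc: "?G \<subseteq> carrier_vec n" using G by blast
    from dim obtain x y where xy: "x \<in> F" "y \<in> F" "x - y \<noteq> 0\<^sub>v n"
      and par: "\<And>x' y'. x' \<in> F \<Longrightarrow> y' \<in> F \<Longrightarrow> \<exists>t. x' - y' = t \<cdot>\<^sub>v (x - y)"
      unfolding affine_dim_eq_1_iff[OF Fc] by blast
    have xyc: "x \<in> carrier_vec n" "y \<in> carrier_vec n" using xy Fc by auto
    have diff: "C *\<^sub>v x - C *\<^sub>v y = C *\<^sub>v (x - y)"
      by (rule mult_minus_distrib_mat_vec[OF C xyc, symmetric])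
    show ?thesis unfolding affine_dim_eq_1_iff[OF Gc]
    proof (intro bexI conjI ballI)
      show "C *\<^sub>v x - C *\<^sub>v y \<noteq> 0\<^sub>v n"
      proof
        assume "C *\<^sub>v x - C *\<^sub>v y = 0\<^sub>v n"
        then have "?R *\<^sub>v (C *\<^sub>v (x - y)) = 0\<^sub>v n" unfolding diff using R by auto
        with RC[of "x - y"] xyc xy(3) show False by simp
      qed
      fix x' y' assume "x' \<in> ?G" "y' \<in> ?G"
      then have x': "x' \<in> carrier_vec n" "?R *\<^sub>v x' \<in> F" and y': "y' \<in> carrier_vec n" "?R *\<^sub>v y' \<in> F"
        unfolding G by auto
      obtain t where t: "?R *\<^sub>v x' - ?R *\<^sub>v y' = t \<cdot>\<^sub>v (x - y)" using par[OF x'(2) y'(2)] by blast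
      have "x' - y' = C *\<^sub>v (?R *\<^sub>v (x' - y'))" using CR[of "x' - y'"] x' y' by simp
      also have "?R *\<^sub>v (x' - y') = t \<cdot>\<^sub>v (x - y)"
        using mult_minus_distrib_mat_vec[OF R x'(1) y'(1)] t by simp
      also have "C *\<^sub>v \<dots> = t \<cdot>\<^sub>v (C *\<^sub>v x - C *\<^sub>v y)"
        unfolding diff by (rule mult_mat_vec_smult[OF C]) (use xyc in simp)
      finally show "\<exists>t. x' - y' = t \<cdot>\<^sub>v (C *\<^sub>v x - C *\<^sub>v y)" by blast
    qed (use CG xy in auto)
  qed
  ultimately show ?thesis using A B by (simp add: extreme_ray_def)
qed

lemma extreme_ray_dim_pos:
  assumes A: "A \<in> carrier_mat m n" and F: "extreme_ray A F"
  shows "n \<noteq> 0"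
proof
  assume n: "n = 0"
  have face: "is_face n (cone_of A) F" and dim: "vec_space.affine_dim n F = 1"
    using F A by (auto simp: extreme_ray_def)
  have Fc: "F \<subseteq> carrier_vec n" using faceD(1)[OF A face] cone_of_iff[OF A] by auto
  from dim obtain x y where "x \<in> F" "y \<in> F" "x - y \<noteq> 0\<^sub>v n"
    unfolding affine_dim_eq_1_iff[OF Fc] by blast
  moreover from this have "x - y \<in> carrier_vec n" using Fc minus_carrier_vec by blast
  moreover have "z = 0\<^sub>v n" if "z \<in> carrier_vec n" for z :: "real vec"
    by (rule eq_vecI) (use that n in auto)
  ultimately show False by simp
qed

lemma ray_index_sets_preimage:
  assumes A: "A \<in> carrier_mat m (Suc q)" and B: "B \<in> carrier_mat (Suc q) (Suc q)" and dB: "det B \<noteq> 0"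
    and Fc: "F \<subseteq> carrier_vec (Suc q)"
  shows "ray_index_sets (A * B) (ray_preimage B F) = ray_index_sets A F"
proof -
  let ?n = "Suc q"
  let ?R = "real_mat B"
  have R: "?R \<in> carrier_mat ?n ?n" using B by simp
  have AB: "A * B \<in> carrier_mat m ?n" using A B by simp
  obtain C where C: "C \<in> carrier_mat ?n ?n"
    and "\<And>x. x \<in> carrier_vec ?n \<Longrightarrow> C *\<^sub>v (real_mat B *\<^sub>v x) = x"
    and RC: "\<And>x. x \<in> carrier_vec ?n \<Longrightarrow> real_mat B *\<^sub>v (C *\<^sub>v x) = x"
    using real_inverse[OF B dB] by blast
  have "I \<in> ray_index_sets (A * B) (ray_preimage B F) \<longleftrightarrow> I \<in> ray_index_sets A F"
    if I: "I \<subseteq> {..<m}" "card I = q" for I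
  proof -
    define M where "M = submatrix A I UNIV"
    have M: "M \<in> carrier_mat q ?n" using submatrix_rows_carrier[OF A I(1)] I(2) by (simp add: M_def)
    have MB: "M * B \<in> carrier_mat q ?n" using M B by simp
    have sub: "submatrix (A * B) I UNIV = M * B" unfolding M_def by (rule submatrix_mult[OF A B I(1)])
    have c: "signed_minors M \<in> carrier_vec ?n" "signed_minors (M * B) \<in> carrier_vec ?n"
      using signed_minors_carrier M MB by auto
    have e: "B *\<^sub>v signed_minors (M * B) = det B \<cdot>\<^sub>v signed_minors M"
      by (rule mult_signed_minors_mult[OF M B])
    have "signed_minors (M * B) = 0\<^sub>v ?n \<longleftrightarrow> signed_minors M = 0\<^sub>v ?n"
    proof
      assume z': "signed_minors (M * B) = 0\<^sub>v ?n"
      have "B *\<^sub>v 0\<^sub>v ?n = 0\<^sub>v ?n" by (rule eq_vecI) (use B in auto)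
      then have z: "det B \<cdot>\<^sub>v signed_minors M = 0\<^sub>v ?n" using e unfolding z' by simp
      show "signed_minors M = 0\<^sub>v ?n"
      proof (rule eq_vecI)
        fix i assume "i < dim_vec (0\<^sub>v ?n)"
        then have "i < ?n" by simp
        then show "signed_minors M $ i = 0\<^sub>v ?n $ i"
          using arg_cong[OF z, of "\<lambda>v. v $ i"] c dB by simp
      qed (use c in auto)
    next
      assume z': "signed_minors M = 0\<^sub>v ?n"
      have "det B \<cdot>\<^sub>v 0\<^sub>v ?n = 0\<^sub>v ?n" by (rule eq_vecI) auto
      then have "B *\<^sub>v signed_minors (M * B) = 0\<^sub>v ?n" using e unfolding z' by simp
      then show "signed_minors (M * B) = 0\<^sub>v ?n"
        using det_0_iff_vec_prod_zero[OF B] dB c(2) by blast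
    qed
    then have rank: "int_rank (M * B) = q \<longleftrightarrow> int_rank M = q"
      unfolding int_rank_eq_rows_iff[OF M] int_rank_eq_rows_iff[OF MB] by simp
    have rM: "real_mat M \<in> carrier_mat q ?n" using M by simp
    have assoc: "real_mat (M * B) *\<^sub>v x = real_mat M *\<^sub>v (?R *\<^sub>v x)" if "x \<in> carrier_vec ?n" for x
      unfolding real_mat_mult[OF M B] by (rule assoc_mult_mat_vec[OF rM R that])
    have G: "x \<in> ray_preimage B F \<longleftrightarrow> x \<in> carrier_vec ?n \<and> ?R *\<^sub>v x \<in> F" for x
      using B by (auto simp: ray_preimage_def)
    have "(\<forall>x \<in> ray_preimage B F. real_mat (M * B) *\<^sub>v x = 0\<^sub>v q) \<longleftrightarrow>
        (\<forall>x \<in> F. real_mat M *\<^sub>v x = 0\<^sub>v q)"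
    proof
      assume *: "\<forall>x \<in> ray_preimage B F. real_mat (M * B) *\<^sub>v x = 0\<^sub>v q"
      show "\<forall>x \<in> F. real_mat M *\<^sub>v x = 0\<^sub>v q"
      proof
        fix x assume x: "x \<in> F"
        then have xc: "x \<in> carrier_vec ?n" using Fc by blast
        then have "C *\<^sub>v x \<in> ray_preimage B F" using C RC x unfolding G by simp
        with * assoc[of "C *\<^sub>v x"] C RC[OF xc] xc show "real_mat M *\<^sub>v x = 0\<^sub>v q" by simp
      qed
    qed (use assoc G in auto)
    with rank show ?thesis
      using A AB B I unfolding ray_index_sets_def by (simp add: sub M_def[symmetric])
  qed
  then show ?thesis using A AB B by (auto simp: ray_index_sets_def)
qed

text \<open>
  All index sets of a ray have proportional minor vectors, because these span kernels of dimension 1 that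
  contain the ray; so \<open>I\<close> stays maximizing for \<open>A * B\<close>. The generator \<open>r'\<close> is, up to sign, the minor vector
  of \<open>A * B\<close> for \<open>I\<close>.
\<close>

lemma normalized_generator_preimage:
  assumes A: "A \<in> carrier_mat m n" and B: "B \<in> carrier_mat n n" and dB: "det B \<noteq> 0"
    and r: "r \<in> normalized_generators A"
  shows "\<exists>r' \<in> normalized_generators (A * B).
    r' \<in> carrier_vec n \<and> B *\<^sub>v r' = \<bar>det B\<bar> \<cdot>\<^sub>v r"
proof -
  from r obtain F I where F: "extreme_ray A F" and I: "I \<in> ray_index_sets A F"
    and mx: "\<And>J. J \<in> ray_index_sets A F \<Longrightarrow>
        mat_gcd (submatrix A J UNIV) \<le> mat_gcd (submatrix A I UNIV)"
    and rF: "real_vec r \<in> F" and rI: "r = minor_vec A I \<or> r = - minor_vec A I"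
    unfolding normalized_generators_def by blast
  obtain q where n: "n = Suc q" using extreme_ray_dim_pos[OF A F] not0_implies_Suc by blast
  note A = A[unfolded n] and B = B[unfolded n]
  have AB: "A * B \<in> carrier_mat m (Suc q)" using A B by simp
  have face: "is_face (Suc q) (cone_of A) F" using F A by (auto simp: extreme_ray_def)
  have Fc: "F \<subseteq> carrier_vec (Suc q)" using faceD(1)[OF A face] cone_of_iff[OF A] by auto
  define M where "M J = submatrix A J UNIV" for J
  have J: "J \<subseteq> {..<m}" "M J \<in> carrier_mat q (Suc q)" "signed_minors (M J) \<noteq> 0\<^sub>v (Suc q)"
    "real_mat (M J) *\<^sub>v real_vec r = 0\<^sub>v q" if J: "J \<in> ray_index_sets A F" for J
  proof -
    from J A have J': "J \<subseteq> {..<m}" "card J = q" "int_rank (M J) = q"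
      "\<forall>x \<in> F. real_mat (M J) *\<^sub>v x = 0\<^sub>v q"
      by (auto simp: ray_index_sets_def M_def)
    show "J \<subseteq> {..<m}" by (rule J'(1))
    show c: "M J \<in> carrier_mat q (Suc q)"
      using submatrix_rows_carrier[OF A J'(1)] J'(2) by (simp add: M_def)
    show "signed_minors (M J) \<noteq> 0\<^sub>v (Suc q)" using int_rank_eq_rows_iff[OF c] J'(3) by blast
    show "real_mat (M J) *\<^sub>v real_vec r = 0\<^sub>v q" using J'(4) rF by blast
  qed
  let ?s = "signed_minors (M I)"
  have s: "?s \<in> carrier_vec (Suc q)" by (rule signed_minors_carrier[OF J(2)[OF I]])
  have rs: "r = ?s \<or> r = - ?s"
    using rI minor_vec_eq_signed_minors[OF A J(1)[OF I]] by (simp add: M_def)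
  have rc: "r \<in> carrier_vec (Suc q)" using rs s by auto
  have r0: "r \<noteq> 0\<^sub>v (Suc q)" 
  proof
    assume z: "r = 0\<^sub>v (Suc q)"
    have "?s = 0\<^sub>v (Suc q)"
    proof (rule eq_vecI)
      fix i assume "i < dim_vec (0\<^sub>v (Suc q))"
      then have "i < Suc q" by simp
      then show "?s $ i = 0\<^sub>v (Suc q) $ i"
        using rs s arg_cong[OF z, of "\<lambda>v. v $ i"] by auto
    qed (use s in auto)
    with J(3)[OF I] show False ..
  qed
  have par: "\<exists>t. real_vec (signed_minors (M K)) = t \<cdot>\<^sub>v real_vec ?s" if K: "K \<in> ray_index_sets A F" for K
  proof -
    let ?k = "signed_minors (M K)"
    have k: "?k \<in> carrier_vec (Suc q)" by (rule signed_minors_carrier[OF J(2)[OF K]])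
    obtain t where t: "real_vec r = t \<cdot>\<^sub>v real_vec ?k"
      using kernel_on_line_signed_minors[OF J(2,3)[OF K] _ J(4)[OF K]] rc by auto
    have "t \<noteq> 0"
    proof
      assume "t = 0"
      then have "real_vec r = 0\<^sub>v (Suc q)" unfolding t using k by (intro eq_vecI) auto
      with r0 show False by (simp add: real_vec_eq_0)
    qed
    then have "real_vec ?k = (1 / t) \<cdot>\<^sub>v real_vec r"
      unfolding t using k by (intro eq_vecI) auto
    also have "\<exists>u. \<dots> = u \<cdot>\<^sub>v real_vec ?s"
      using rs
    proof
      assume "r = - ?s"
      then have "(1 / t) \<cdot>\<^sub>v real_vec r = (- 1 / t) \<cdot>\<^sub>v real_vec ?s"
        using s by (intro eq_vecI) auto
      then show ?thesis by blast
    qed blast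
    finally show ?thesis .
  qed
  let ?G = "ray_preimage B F"
  have ix: "ray_index_sets (A * B) ?G = ray_index_sets A F"
    by (rule ray_index_sets_preimage[OF A B dB Fc])
  have sub: "submatrix (A * B) K UNIV = M K * B" if "K \<in> ray_index_sets A F" for K
    unfolding M_def by (rule submatrix_mult[OF A B J(1)[OF that]])
  have mx': "mat_gcd (submatrix (A * B) K UNIV) \<le> mat_gcd (submatrix (A * B) I UNIV)"
    if K: "K \<in> ray_index_sets A F" for K
  proof -
    obtain t where "real_vec (signed_minors (M K)) = t \<cdot>\<^sub>v real_vec ?s" using par[OF K] by blast
    from mat_gcd_le_mult[OF J(2)[OF I] J(2)[OF K] B dB J(3)[OF I] this] mx[OF K]
    show ?thesis unfolding sub[OF K] sub[OF I] by (simp add: M_def)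
  qed
  define u where "u = minor_vec (A * B) I"
  have u: "u = signed_minors (M I * B)"
    unfolding u_def minor_vec_eq_signed_minors[OF AB J(1)[OF I]] sub[OF I] ..
  have uc: "u \<in> carrier_vec (Suc q)"
    unfolding u by (rule signed_minors_carrier[where r = q]) (use J(2)[OF I] B in simp)
  have Bu: "B *\<^sub>v u = det B \<cdot>\<^sub>v ?s" unfolding u by (rule mult_signed_minors_mult[OF J(2)[OF I] B])
  have Bnu: "B *\<^sub>v (- u) = - (det B \<cdot>\<^sub>v ?s)"
  proof -
    have "- u = (-1) \<cdot>\<^sub>v u" by (intro eq_vecI) auto
    then have "B *\<^sub>v (- u) = (-1) \<cdot>\<^sub>v (B *\<^sub>v u)" using mult_mat_vec_smult[OF B uc] by simp
    also have "\<dots> = - (det B \<cdot>\<^sub>v ?s)" unfolding Bu by (intro eq_vecI) auto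
    finally show ?thesis .
  qed
  \<comment> \<open>the sign that cancels the sign of \<open>det B\<close> and the sign of \<open>r\<close> relative to its minor vector\<close>
  define r' where "r' = (if (r = ?s) = (det B > 0) then u else - u)"
  have r'c: "r' \<in> carrier_vec (Suc q)" using uc by (simp add: r'_def)
  have Br': "B *\<^sub>v r' = \<bar>det B\<bar> \<cdot>\<^sub>v r"
    using rs s dB by (cases "r = ?s"; cases "det B > 0") (auto simp: r'_def Bu Bnu)
  have "real_mat B *\<^sub>v real_vec r' = real_vec (B *\<^sub>v r')"
    by (rule real_mat_mult_vec) (use r'c B in simp)
  also have "\<dots> = real_of_int \<bar>det B\<bar> \<cdot>\<^sub>v real_vec r" unfolding Br' by (intro eq_vecI) auto
  also have "\<dots> \<in> F" by (rule faceD(2)[OF A face rF]) simp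
  finally have "real_vec r' \<in> ?G" using r'c B by (simp add: ray_preimage_def)
  moreover have "r' = minor_vec (A * B) I \<or> r' = - minor_vec (A * B) I" by (simp add: r'_def u_def)
  moreover note extreme_ray_preimage[OF A B dB F]
  ultimately have "r' \<in> normalized_generators (A * B)"
    unfolding normalized_generators_def using ix I mx' by blast
  then show ?thesis using r'c Br' n by blast
qed

section \<open>Nonnegative combinations of bounded weight\<close>

text \<open>
  Nonnegative combinations built one summand at a time, with \<open>t\<close> as total weight. Repeated elements of \<open>S\<close>
  are allowed, which makes sums and linear images immediate; membership in the convex hull of \<open>0\<close> and \<open>S\<close>
  means that some combination has weight at most 1.
\<close>

inductive cone_comb :: "nat \<Rightarrow> real vec set \<Rightarrow> real \<Rightarrow> real vec \<Rightarrow> bool" for n S where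
  zero: "cone_comb n S 0 (0\<^sub>v n)"
| step: "cone_comb n S t x \<Longrightarrow> v \<in> S \<Longrightarrow> v \<in> carrier_vec n \<Longrightarrow> 0 \<le> a \<Longrightarrow>
    cone_comb n S (t + a) (x + a \<cdot>\<^sub>v v)"

lemma cone_comb_carrier: "cone_comb n S t x \<Longrightarrow> x \<in> carrier_vec n"
  by (induction rule: cone_comb.induct) auto

lemma cone_comb_add:
  assumes "cone_comb n S t x" "cone_comb n S u y"
  shows "cone_comb n S (t + u) (x + y)"
  using assms(2)
proof (induction rule: cone_comb.induct)
  case zero
  then show ?case using assms(1) cone_comb_carrier[OF assms(1)] by simp
next
  case (step u y v a)
  have "x + (y + a \<cdot>\<^sub>v v) = (x + y) + a \<cdot>\<^sub>v v"
    using cone_comb_carrier[OF assms(1)] cone_comb_carrier[OF step(1)] step(3)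
    by (intro assoc_add_vec[symmetric]) auto
  then show ?case using cone_comb.step[OF step(5,2,3,4)] by (simp add: add.assoc)
qed

lemma cone_comb_mult_mat_vec:
  assumes C: "C \<in> carrier_mat n n" and q: "0 \<le> q"
    and gen: "\<And>v. v \<in> S \<Longrightarrow> \<exists>v' \<in> S'. v' \<in> carrier_vec n \<and> C *\<^sub>v v = q \<cdot>\<^sub>v v'"
    and x: "cone_comb n S t x"
  shows "cone_comb n S' (t * q) (C *\<^sub>v x)"
  using x
proof (induction rule: cone_comb.induct)
  case zero
  have "C *\<^sub>v 0\<^sub>v n = 0\<^sub>v n" using C by (intro eq_vecI) auto
  then show ?case using cone_comb.zero by simp
next
  case (step t x v a)
  obtain v' where v': "v' \<in> S'" "v' \<in> carrier_vec n" "C *\<^sub>v v = q \<cdot>\<^sub>v v'" using gen[OF step(2)] by blast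
  have "C *\<^sub>v (x + a \<cdot>\<^sub>v v) = C *\<^sub>v x + a \<cdot>\<^sub>v (C *\<^sub>v v)"
    using cone_comb_carrier[OF step(1)] step(3)
    by (subst mult_add_distrib_mat_vec[OF C]) (auto simp: mult_mat_vec_smult[OF C])
  also have "\<dots> = C *\<^sub>v x + (a * q) \<cdot>\<^sub>v v'" unfolding v'(3) by (simp add: smult_smult_assoc)
  finally show ?case
    using cone_comb.step[OF step(5) v'(1,2), of "a * q"] step(4) q by (simp add: distrib_right)
qed

lemma cone_comb_imp_sum:
  assumes "cone_comb n S t x"
  shows "\<exists>T c. finite T \<and> T \<subseteq> S \<and> (\<forall>v \<in> T. 0 \<le> c v) \<and> sum c T = t \<and>
    x = vec n (\<lambda>i. \<Sum>v\<in>T. c v * v $ i)"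
  using assms
proof (induction rule: cone_comb.induct)
  case zero
  show ?case by (intro exI[of _ "{}"] exI[of _ "\<lambda>_. 0"]) auto
next
  case (step t x v a)
  then obtain T c where T: "finite T" "T \<subseteq> S" "\<forall>v \<in> T. 0 \<le> c v" "sum c T = t"
    "x = vec n (\<lambda>i. \<Sum>v\<in>T. c v * v $ i)" by blast
  let ?c = "\<lambda>w. (if w \<in> T then c w else 0) + (if w = v then a else 0)"
  let ?T = "insert v T"
  have s: "(\<Sum>w\<in>?T. ?c w * f w) = (\<Sum>w\<in>T. c w * f w) + a * f v" for f :: "real vec \<Rightarrow> real"
  proof -
    have "(\<Sum>w\<in>?T. ?c w * f w) =
        (\<Sum>w\<in>?T. (if w \<in> T then c w * f w else 0)) + (\<Sum>w\<in>?T. if w = v then a * f w else 0)"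
      unfolding sum.distrib[symmetric] by (rule sum.cong) (auto simp: distrib_right)
    also have "(\<Sum>w\<in>?T. (if w \<in> T then c w * f w else 0)) = (\<Sum>w\<in>T. c w * f w)"
      by (rule sum.mono_neutral_cong_right) (use T(1) in auto)
    finally show ?thesis using T(1) by simp
  qed
  show ?case
  proof (intro exI conjI)
    show "finite ?T" "?T \<subseteq> S" using T step(2) by auto
    show "\<forall>w \<in> ?T. 0 \<le> ?c w" using T(3) step(4) by auto
    show "sum ?c ?T = t + a" using s[of "\<lambda>_. 1"] T(4) by simp
    show "x + a \<cdot>\<^sub>v v = vec n (\<lambda>i. \<Sum>w\<in>?T. ?c w * w $ i)"
      unfolding s T(5) by (rule eq_vecI) (use step(3) in auto)
  qed
qed

lemma cone_comb_mono: "cone_comb n S t x \<Longrightarrow> S \<subseteq> S' \<Longrightarrow> cone_comb n S' t x"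
  by (induction rule: cone_comb.induct) (auto intro: cone_comb.intros)

lemma cone_comb_imp_conv_hull:
  assumes x: "cone_comb n S t x" and t: "t \<le> 1"
  shows "x \<in> conv_hull n ({0\<^sub>v n} \<union> S)"
proof -
  have "cone_comb n ({0\<^sub>v n} \<union> S) t x" by (rule cone_comb_mono[OF x]) auto
  from cone_comb.step[OF this, of "0\<^sub>v n" "1 - t"] t
  have "cone_comb n ({0\<^sub>v n} \<union> S) 1 (x + (1 - t) \<cdot>\<^sub>v 0\<^sub>v n)" by simp
  moreover have "x + (1 - t) \<cdot>\<^sub>v 0\<^sub>v n = x"
    by (rule eq_vecI) (use cone_comb_carrier[OF x] in auto)
  ultimately have "cone_comb n ({0\<^sub>v n} \<union> S) 1 x" by simp
  from cone_comb_imp_sum[OF this] obtain T c where "finite T" "T \<subseteq> {0\<^sub>v n} \<union> S"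
    "\<forall>v \<in> T. 0 \<le> c v" "sum c T = 1" "x = vec n (\<lambda>i. \<Sum>v\<in>T. c v * v $ i)" by blast
  then show ?thesis unfolding conv_hull_def mem_Collect_eq
    by (intro exI[of _ T] exI[of _ c]) simp
qed

lemma conv_hull_imp_cone_comb:
  assumes S: "S \<subseteq> carrier_vec n" and x: "x \<in> conv_hull n ({0\<^sub>v n} \<union> S)"
  shows "\<exists>t\<le>1. cone_comb n S t x"
proof -
  from x obtain T c where T: "finite T" "T \<subseteq> {0\<^sub>v n} \<union> S" "\<forall>v \<in> T. 0 \<le> c v" "sum c T = 1"
    "x = vec n (\<lambda>i. \<Sum>v\<in>T. c v * v $ i)" unfolding conv_hull_def by blast
  have "\<exists>t \<le> sum c T. cone_comb n S t (vec n (\<lambda>i. \<Sum>v\<in>T. c v * v $ i))"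
    using T(1,2,3)
  proof (induction T rule: finite_induct)
    case empty
    have "vec n (\<lambda>i. \<Sum>v\<in>{}. c v * v $ i) = 0\<^sub>v n" by (rule eq_vecI) auto
    then show ?case using cone_comb.zero[of n S] by auto
  next
    case (insert v T)
    then obtain t where t: "t \<le> sum c T" "cone_comb n S t (vec n (\<lambda>i. \<Sum>v\<in>T. c v * v $ i))" by auto
    have cv: "0 \<le> c v" using insert.prems by simp
    have vc: "v \<in> carrier_vec n" using insert.prems S by auto
    have e: "vec n (\<lambda>i. \<Sum>v\<in>insert v T. c v * v $ i) = vec n (\<lambda>i. \<Sum>v\<in>T. c v * v $ i) + c v \<cdot>\<^sub>v v"
      by (rule eq_vecI) (use insert.hyps vc in auto)
    show ?case
    proof (cases "v \<in> S")
      case True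
      have "t + c v \<le> sum c (insert v T)" using t(1) insert.hyps by simp
      then show ?thesis unfolding e using cone_comb.step[OF t(2) True vc cv] by blast
    next
      case False
      then have "v = 0\<^sub>v n" using insert.prems by auto
      then have e': "vec n (\<lambda>i. \<Sum>v\<in>insert v T. c v * v $ i) = vec n (\<lambda>i. \<Sum>v\<in>T. c v * v $ i)"
        unfolding e by (intro eq_vecI) auto
      have "t \<le> sum c (insert v T)" using t(1) cv insert.hyps by simp
      with t(2) show ?thesis unfolding e' by blast
    qed
  qed
  with T(4,5) show ?thesis by simp
qed

section \<open>Hilbert bases\<close>

definition lattice_cone :: "int mat \<Rightarrow> int vec set" where
  "lattice_cone A = {z \<in> carrier_vec (dim_col A). \<forall>i < dim_row A. 0 \<le> (A *\<^sub>v z) $ i}"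

lemma real_vec_in_cone_of_iff: "real_vec z \<in> cone_of A \<longleftrightarrow> z \<in> lattice_cone A"
proof -
  have A: "A \<in> carrier_mat (dim_row A) (dim_col A)" by simp
  have "real_mat A *\<^sub>v real_vec z = real_vec (A *\<^sub>v z)" if "z \<in> carrier_vec (dim_col A)"
    by (rule real_mat_mult_vec[OF that])
  then show ?thesis unfolding cone_of_iff[OF A] lattice_cone_def
    by (auto simp del: index_mult_mat_vec)
qed

lemma hilbert_basis_element_iff:
  assumes "A \<in> carrier_mat m n"
  shows "hilbert_basis_element A h \<longleftrightarrow> h \<noteq> 0\<^sub>v n \<and> h \<in> lattice_cone A \<and>
    (\<forall>z1 \<in> lattice_cone A. \<forall>z2 \<in> lattice_cone A. h = z1 + z2 \<longrightarrow> z1 = 0\<^sub>v n \<or> z2 = 0\<^sub>v n)"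
  using assms unfolding hilbert_basis_element_def real_vec_in_cone_of_iff by auto

definition vec_sum :: "nat \<Rightarrow> int vec list \<Rightarrow> int vec" where
  "vec_sum n zs = foldr (+) zs (0\<^sub>v n)"

lemma vec_sum_carrier: "set zs \<subseteq> carrier_vec n \<Longrightarrow> vec_sum n zs \<in> carrier_vec n"
  by (induction zs) (auto simp: vec_sum_def)

lemma vec_sum_append:
  assumes "set xs \<subseteq> carrier_vec n" "set ys \<subseteq> carrier_vec n"
  shows "vec_sum n (xs @ ys) = vec_sum n xs + vec_sum n ys"
  using assms(1)
proof (induction xs)
  case Nil
  then show ?case using vec_sum_carrier[OF assms(2)] by (simp add: vec_sum_def)
next
  case (Cons x xs)
  have "x + vec_sum n xs + vec_sum n ys = x + (vec_sum n xs + vec_sum n ys)"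
    by (rule assoc_add_vec) (use Cons.prems assms(2) vec_sum_carrier in auto)
  with Cons show ?case by (simp add: vec_sum_def)
qed

text \<open>
  A linear functional that is positive on the nonzero integer points of the cone of an injective matrix: it
  witnesses that the cone is pointed and serves as induction measure for decompositions.
\<close>

definition height :: "int mat \<Rightarrow> int vec \<Rightarrow> int" where
  "height A z = (\<Sum>i<dim_row A. (A *\<^sub>v z) $ i)"

context
  fixes A :: "int mat" and m n
  assumes A: "A \<in> carrier_mat m n"
    and inj: "\<And>x. x \<in> carrier_vec n \<Longrightarrow> A *\<^sub>v x = 0\<^sub>v m \<Longrightarrow> x = 0\<^sub>v n"
begin

lemma lattice_cone_iff: "z \<in> lattice_cone A \<longleftrightarrow> z \<in> carrier_vec n \<and> (\<forall>i<m. 0 \<le> (A *\<^sub>v z) $ i)"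
  using A by (auto simp: lattice_cone_def)

lemma lattice_cone_carrier: "lattice_cone A \<subseteq> carrier_vec n"
  using lattice_cone_iff by blast

lemma mult_add_index:
  "x \<in> carrier_vec n \<Longrightarrow> y \<in> carrier_vec n \<Longrightarrow> i < m \<Longrightarrow>
    (A *\<^sub>v (x + y)) $ i = (A *\<^sub>v x) $ i + (A *\<^sub>v y) $ i"
  using A by (subst mult_add_distrib_mat_vec[OF A]) auto

lemma lattice_cone_add: "x \<in> lattice_cone A \<Longrightarrow> y \<in> lattice_cone A \<Longrightarrow> x + y \<in> lattice_cone A"
  unfolding lattice_cone_iff by (auto simp: mult_add_index)

lemma lattice_cone_0: "0\<^sub>v n \<in> lattice_cone A"
  unfolding lattice_cone_iff using A by auto

lemma height_add: "x \<in> carrier_vec n \<Longrightarrow> y \<in> carrier_vec n \<Longrightarrow> height A (x + y) = height A x + height A y"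
  using A by (simp add: height_def mult_add_index sum.distrib del: index_mult_mat_vec)

lemma height_0: "height A (0\<^sub>v n) = 0"
  using A by (simp add: height_def)

lemma height_nonneg: "z \<in> lattice_cone A \<Longrightarrow> 0 \<le> height A z"
  unfolding lattice_cone_iff height_def using A by (auto intro: sum_nonneg)

lemma height_pos:
  assumes z: "z \<in> lattice_cone A" and nz: "z \<noteq> 0\<^sub>v n"
  shows "0 < height A z"
proof (rule ccontr)
  assume "\<not> ?thesis"
  then have "(\<Sum>i<m. (A *\<^sub>v z) $ i) = 0" using height_nonneg[OF z] A by (simp add: height_def)
  then have "\<forall>i\<in>{..<m}. (A *\<^sub>v z) $ i = 0"
    using z unfolding lattice_cone_iff by (subst (asm) sum_nonneg_eq_0_iff) auto
  then have "A *\<^sub>v z = 0\<^sub>v m" by (intro eq_vecI) (use A in auto)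
  with inj z nz show False unfolding lattice_cone_iff by blast
qed

lemma vec_sum_lattice_cone: "set zs \<subseteq> lattice_cone A \<Longrightarrow> vec_sum n zs \<in> lattice_cone A"
  by (induction zs) (auto simp: vec_sum_def lattice_cone_0 lattice_cone_add)

lemma vec_sum_nonzero:
  assumes "set zs \<subseteq> lattice_cone A" "0\<^sub>v n \<notin> set zs" "zs \<noteq> []"
  shows "vec_sum n zs \<noteq> 0\<^sub>v n"
proof -
  obtain x xs where zs: "zs = x # xs" using assms(3) by (cases zs) auto
  have x: "x \<in> lattice_cone A" "x \<noteq> 0\<^sub>v n" and xs: "vec_sum n xs \<in> lattice_cone A"
    using assms vec_sum_lattice_cone[of xs] by (auto simp: zs)
  have "height A (x + vec_sum n xs) = height A x + height A (vec_sum n xs)"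
    by (rule height_add) (use x xs lattice_cone_carrier in auto)
  then have "0 < height A (vec_sum n zs)"
    using height_pos[OF x] height_nonneg[OF xs] by (simp add: zs vec_sum_def)
  then show ?thesis using height_0 by auto
qed

lemma hilbert_decomposition:
  assumes "z \<in> lattice_cone A"
  shows "\<exists>hs. (\<forall>h \<in> set hs. hilbert_basis_element A h) \<and> z = vec_sum n hs"
  using assms
proof (induction "nat (height A z)" arbitrary: z rule: less_induct)
  case less
  have zc: "z \<in> carrier_vec n" using less.prems lattice_cone_carrier by blast
  consider "z = 0\<^sub>v n" | "hilbert_basis_element A z"
    | z1 z2 where "z1 \<in> lattice_cone A" "z2 \<in> lattice_cone A" "z = z1 + z2" "z1 \<noteq> 0\<^sub>v n" "z2 \<noteq> 0\<^sub>v n"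
    using less.prems unfolding hilbert_basis_element_iff[OF A] by blast
  then show ?case
  proof cases
    case 1
    then show ?thesis by (intro exI[of _ "[]"]) (simp add: vec_sum_def)
  next
    case 2
    then show ?thesis using zc by (intro exI[of _ "[z]"]) (simp add: vec_sum_def)
  next
    case 3
    have c: "z1 \<in> carrier_vec n" "z2 \<in> carrier_vec n" using 3 lattice_cone_carrier by auto
    have "height A z = height A z1 + height A z2" unfolding 3(3) by (rule height_add[OF c])
    moreover have "0 < height A z1" "0 < height A z2" using height_pos 3 by auto
    ultimately have "nat (height A z1) < nat (height A z)" "nat (height A z2) < nat (height A z)" by auto
    from less.hyps[OF this(1) 3(1)] less.hyps[OF this(2) 3(2)]
    obtain hs ks where h: "\<forall>h \<in> set hs. hilbert_basis_element A h" "z1 = vec_sum n hs"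
      "\<forall>h \<in> set ks. hilbert_basis_element A h" "z2 = vec_sum n ks" by blast
    have "set hs \<subseteq> carrier_vec n" "set ks \<subseteq> carrier_vec n"
      using h(1,3) lattice_cone_carrier unfolding hilbert_basis_element_iff[OF A] by auto
    then have "z = vec_sum n (hs @ ks)" using vec_sum_append h 3(3) by simp
    then show ?thesis using h by (intro exI[of _ "hs @ ks"]) auto
  qed
qed

end

section \<open>(SHC) and multiplication by a square matrix\<close>

text \<open>
  The pigeonhole argument bounding the Davenport constant of a cyclic group of order \<open>d\<close>: of the first
  \<open>d + 1\<close> partial sums two have the same residue. The block between them is not the whole list, as the list
  has more than \<open>d\<close> members.
\<close>

lemma consecutive_sum_dvd:
  fixes \<kappa> :: "int vec \<Rightarrow> int"
  assumes add: "\<And>x y. x \<in> carrier_vec n \<Longrightarrow> y \<in> carrier_vec n \<Longrightarrow> \<kappa> (x + y) = \<kappa> x + \<kappa> y"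
    and hs: "set hs \<subseteq> carrier_vec n" and d: "0 < d" and len: "d < int (length hs)"
  obtains xs ys zs where "hs = xs @ ys @ zs" "ys \<noteq> []" "xs @ zs \<noteq> []" "d dvd \<kappa> (vec_sum n ys)"
proof -
  define D where "D = nat d"
  have D: "int D = d" using d by (simp add: D_def)
  define P where "P i = \<kappa> (vec_sum n (take i hs)) mod d" for i
  have "P ` {..D} \<subseteq> {0..<d}" using d by (auto simp: P_def)
  then have "card (P ` {..D}) \<le> card {0..<d}" by (intro card_mono) auto
  also have "\<dots> < card {..D}" using D by simp
  finally have "\<not> inj_on P {..D}" using card_image[of P "{..D}"] by auto
  then obtain a b where ab: "a \<le> D" "b \<le> D" "a \<noteq> b" "P a = P b" by (auto simp: inj_on_def)
  define i where "i = min a b"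
  define j where "j = max a b"
  have ij: "i < j" "j \<le> D" "P i = P j" using ab by (auto simp: i_def j_def min_def max_def)
  have jl: "j < length hs" using ij len D by linarith
  let ?xs = "take i hs" and ?ys = "drop i (take j hs)" and ?zs = "drop j hs"
  have t: "take j hs = ?xs @ ?ys"
    using append_take_drop_id[of i "take j hs"] ij by (simp add: min_absorb1)
  have c: "set ?xs \<subseteq> carrier_vec n" "set ?ys \<subseteq> carrier_vec n"
    using hs by (meson set_drop_subset set_take_subset subset_trans)+
  have "\<kappa> (vec_sum n (?xs @ ?ys)) = \<kappa> (vec_sum n ?xs) + \<kappa> (vec_sum n ?ys)"
    unfolding vec_sum_append[OF c] by (rule add[OF vec_sum_carrier[OF c(1)] vec_sum_carrier[OF c(2)]])
  then have "\<kappa> (vec_sum n (take j hs)) = \<kappa> (vec_sum n ?xs) + \<kappa> (vec_sum n ?ys)"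
    unfolding t[symmetric] .
  then have "d dvd \<kappa> (vec_sum n ?ys)"
    using ij(3) unfolding P_def by (metis add_diff_cancel_left' mod_eq_dvd_iff)
  moreover have "hs = ?xs @ ?ys @ ?zs"
    unfolding append_assoc[symmetric] t[symmetric] by simp
  moreover have "?ys \<noteq> []" "?xs @ ?zs \<noteq> []" using ij jl by auto
  ultimately show ?thesis using that by blast
qed

text \<open>
  The hypothesis on \<open>\<kappa>\<close> says that the class of an integer vector modulo \<open>B \<int>\<^sup>n\<close> is determined by the residue
  of \<open>\<kappa>\<close> modulo \<open>det B\<close>, so a decomposition of \<open>B h\<close> into Hilbert basis elements of the cone of \<open>A\<close> with
  more than \<open>\<bar>det B\<bar>\<close> members has a proper block with sum in \<open>B \<int>\<^sup>n\<close>.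
\<close>

lemma SHC_mult_cyclic:
  fixes \<kappa> :: "int vec \<Rightarrow> int"
  assumes A: "A \<in> carrier_mat m n" and rank: "int_rank A = n"
    and B: "B \<in> carrier_mat n n" and dB: "det B \<noteq> 0"
    and add: "\<And>x y. x \<in> carrier_vec n \<Longrightarrow> y \<in> carrier_vec n \<Longrightarrow> \<kappa> (x + y) = \<kappa> x + \<kappa> y"
    and image: "\<And>z. z \<in> carrier_vec n \<Longrightarrow> det B dvd \<kappa> z \<Longrightarrow> \<exists>y \<in> carrier_vec n. z = B *\<^sub>v y"
    and shc: "SHC A"
  shows "SHC (A * B)"
  unfolding SHC_def
proof (intro allI impI)
  fix h assume h: "hilbert_basis_element (A * B) h"
  define d where "d = \<bar>det B\<bar>"
  have d: "0 < d" using dB by (simp add: d_def)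
  have AB: "A * B \<in> carrier_mat m n" using A B by simp
  note inj = full_rank_imp_injective[OF A rank]
  have cone_AB: "z \<in> lattice_cone (A * B) \<longleftrightarrow> z \<in> carrier_vec n \<and> B *\<^sub>v z \<in> lattice_cone A" for z
    unfolding real_vec_in_cone_of_iff[symmetric] cone_of_mult[OF A B]
    using real_mat_mult_vec[of z B] B by auto
  note h = h[unfolded hilbert_basis_element_iff[OF AB]]
  have "h \<in> lattice_cone (A * B)" using h by simp
  then have hc: "h \<in> carrier_vec n" and Bh: "B *\<^sub>v h \<in> lattice_cone A" unfolding cone_AB by simp_all
  have irr: "z1 = 0\<^sub>v n \<or> z2 = 0\<^sub>v n"
    if "z1 \<in> lattice_cone (A * B)" "z2 \<in> lattice_cone (A * B)" "h = z1 + z2" for z1 z2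
    using h that by simp
  note lat = lattice_cone_carrier[OF A inj]
  obtain hs where hs: "\<And>k. k \<in> set hs \<Longrightarrow> hilbert_basis_element A k" and sum: "B *\<^sub>v h = vec_sum n hs"
    using hilbert_decomposition[OF A inj Bh] by blast
  have hs_cone: "set hs \<subseteq> lattice_cone A" and hs_nz: "0\<^sub>v n \<notin> set hs"
    using hs unfolding hilbert_basis_element_iff[OF A] by auto
  have hs_c: "set hs \<subseteq> carrier_vec n" using hs_cone lat by blast
  \<comment> \<open>a longer decomposition would contain a proper block with sum \<open>B y\<close> and split \<open>h\<close> into \<open>y\<close> and \<open>h - y\<close>\<close>
  have len: "int (length hs) \<le> d"
  proof (rule ccontr)
    assume "\<not> ?thesis"
    then obtain xs ys zs where split: "hs = xs @ ys @ zs" "ys \<noteq> []" "xs @ zs \<noteq> []"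
      "d dvd \<kappa> (vec_sum n ys)"
      using consecutive_sum_dvd[OF add hs_c d] by (metis not_le)
    have c: "set xs \<subseteq> carrier_vec n" "set ys \<subseteq> carrier_vec n" "set zs \<subseteq> carrier_vec n"
      using hs_c by (auto simp: split(1))
    have cone: "set ys \<subseteq> lattice_cone A" "set (xs @ zs) \<subseteq> lattice_cone A"
      "0\<^sub>v n \<notin> set ys" "0\<^sub>v n \<notin> set (xs @ zs)"
      using hs_cone hs_nz by (auto simp: split(1))
    define w where "w = vec_sum n ys"
    define v where "v = vec_sum n (xs @ zs)"
    have w: "w \<in> lattice_cone A" "w \<noteq> 0\<^sub>v n"
      unfolding w_def using vec_sum_lattice_cone[OF A inj cone(1)] vec_sum_nonzero[OF A inj cone(1,3) split(2)]
      by auto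
    have v: "v \<in> lattice_cone A" "v \<noteq> 0\<^sub>v n"
      unfolding v_def using vec_sum_lattice_cone[OF A inj cone(2)] vec_sum_nonzero[OF A inj cone(2,4) split(3)]
      by auto
    have wc: "w \<in> carrier_vec n" and vc: "v \<in> carrier_vec n" using w v lat by auto
    have Bh_sum: "B *\<^sub>v h = w + v"
    proof -
      have "vec_sum n hs = vec_sum n xs + (vec_sum n ys + vec_sum n zs)"
        unfolding split(1) using c by (simp add: vec_sum_append)
      also have "\<dots> = vec_sum n ys + (vec_sum n xs + vec_sum n zs)"
        using vec_sum_carrier c by (intro eq_vecI) auto
      finally show ?thesis unfolding sum w_def v_def vec_sum_append[OF c(1,3)] .
    qed
    have "det B dvd \<kappa> w" using split(4) by (simp add: d_def w_def)
    from image[OF wc this] obtain y where y: "y \<in> carrier_vec n" "w = B *\<^sub>v y" by blast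
    have By: "B *\<^sub>v (h - y) = v"
      unfolding mult_minus_distrib_mat_vec[OF B hc y(1)] Bh_sum y(2)[symmetric]
      by (rule eq_vecI) (use wc vc in auto)
    have "y \<in> lattice_cone (A * B)" "h - y \<in> lattice_cone (A * B)"
      using cone_AB y w v By hc by auto
    moreover have "h = y + (h - y)" by (rule eq_vecI) (use hc y in auto)
    ultimately have "y = 0\<^sub>v n \<or> h - y = 0\<^sub>v n" by (rule irr)
    moreover have "B *\<^sub>v 0\<^sub>v n = 0\<^sub>v n" by (rule eq_vecI) (use B in auto)
    ultimately show False using w(2) v(2) y(2) By by metis
  qed
  define R where "R = real_vec ` normalized_generators A"
  define R' where "R' = real_vec ` normalized_generators (A * B)"
  have Rc: "R \<subseteq> carrier_vec n"
    unfolding R_def normalized_generators_def using A by (auto simp: minor_vec_def)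
  have piece: "\<exists>t\<le>1. cone_comb n R t (real_vec k)" if "k \<in> set hs" for k
    using shc hs[OF that] A conv_hull_imp_cone_comb[OF Rc] unfolding SHC_def R_def by auto
  have "\<exists>t \<le> real (length ks). cone_comb n R t (real_vec (vec_sum n ks))"
    if "set ks \<subseteq> set hs" for ks
    using that
  proof (induction ks)
    case Nil
    have e: "real_vec (vec_sum n []) = 0\<^sub>v n" by (rule eq_vecI) (auto simp: vec_sum_def)
    show ?case unfolding e using cone_comb.zero[of n R] by auto
  next
    case (Cons k ks)
    then obtain t where t: "t \<le> real (length ks)" "cone_comb n R t (real_vec (vec_sum n ks))" by auto
    obtain u where u: "u \<le> 1" "cone_comb n R u (real_vec k)" using piece[of k] Cons.prems by auto
    have ks: "set ks \<subseteq> carrier_vec n" "k \<in> carrier_vec n" using Cons.prems hs_c by auto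
    have "real_vec (vec_sum n (k # ks)) = real_vec k + real_vec (vec_sum n ks)"
      using vec_sum_carrier[OF ks(1)] ks(2) by (intro eq_vecI) (auto simp: vec_sum_def)
    then show ?case using cone_comb_add[OF u(2) t(2)] u(1) t(1) by (intro exI[of _ "u + t"]) auto
  qed
  from this[of hs] obtain t where t: "t \<le> real (length hs)" "cone_comb n R t (real_vec (B *\<^sub>v h))"
    unfolding sum by auto
  obtain C where C: "C \<in> carrier_mat n n"
    and CB: "\<And>x. x \<in> carrier_vec n \<Longrightarrow> C *\<^sub>v (real_mat B *\<^sub>v x) = x"
    and "\<And>x. x \<in> carrier_vec n \<Longrightarrow> real_mat B *\<^sub>v (C *\<^sub>v x) = x"
    using real_inverse[OF B dB] by blast
  have "\<exists>v' \<in> R'. v' \<in> carrier_vec n \<and> C *\<^sub>v v = (1 / real_of_int d) \<cdot>\<^sub>v v'" if v: "v \<in> R" for v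
  proof -
    obtain r where r: "r \<in> normalized_generators A" "v = real_vec r" using v by (auto simp: R_def)
    obtain r' where r': "r' \<in> normalized_generators (A * B)" "r' \<in> carrier_vec n"
      "B *\<^sub>v r' = \<bar>det B\<bar> \<cdot>\<^sub>v r"
      using normalized_generator_preimage[OF A B dB r(1)] by blast
    have vc: "v \<in> carrier_vec n" using Rc v by blast
    have "real_of_int d \<cdot>\<^sub>v v = real_vec (B *\<^sub>v r')"
      unfolding r'(3) r(2) d_def by (rule eq_vecI) auto
    also have "\<dots> = real_mat B *\<^sub>v real_vec r'"
      by (rule real_mat_mult_vec[symmetric]) (use r' B in simp)
    finally have "C *\<^sub>v (real_of_int d \<cdot>\<^sub>v v) = real_vec r'" using CB[of "real_vec r'"] r'(2) by simp
    then have "real_of_int d \<cdot>\<^sub>v (C *\<^sub>v v) = real_vec r'" using mult_mat_vec_smult[OF C vc] by simp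
    then have "(1 / real_of_int d) \<cdot>\<^sub>v real_vec r' = (1 / real_of_int d) \<cdot>\<^sub>v (real_of_int d \<cdot>\<^sub>v (C *\<^sub>v v))"
      by simp
    also have "\<dots> = C *\<^sub>v v" using d by (simp add: smult_smult_assoc)
    finally show ?thesis using r'(1,2) unfolding R'_def by (intro bexI[of _ "real_vec r'"]) auto
  qed
  from cone_comb_mult_mat_vec[OF C _ this t(2)] d
  have "cone_comb n R' (t * (1 / real_of_int d)) (C *\<^sub>v real_vec (B *\<^sub>v h))" by simp
  moreover have "C *\<^sub>v real_vec (B *\<^sub>v h) = real_vec h"
    using CB[of "real_vec h"] real_mat_mult_vec[of h B] hc B by simp
  moreover have "t * (1 / real_of_int d) \<le> 1" using t(1) len d by (simp add: field_simps)
  ultimately have "real_vec h \<in> conv_hull n ({0\<^sub>v n} \<union> R')"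
    using cone_comb_imp_conv_hull by metis
  then show "real_vec h \<in> conv_hull (dim_col (A * B))
      ({0\<^sub>v (dim_col (A * B))} \<union> real_vec ` normalized_generators (A * B))"
    using B by (simp add: R'_def)
qed

lemma int_rank_mult:
  assumes A: "A \<in> carrier_mat m n" and B: "B \<in> carrier_mat n n" and dB: "det B \<noteq> 0"
  shows "int_rank (A * B) = n \<longleftrightarrow> int_rank A = n"
proof -
  have AB: "A * B \<in> carrier_mat m n" using A B by simp
  have R: "real_mat B \<in> carrier_mat n n" using B by simp
  obtain C where C: "C \<in> carrier_mat n n"
    and CB: "\<And>x. x \<in> carrier_vec n \<Longrightarrow> C *\<^sub>v (real_mat B *\<^sub>v x) = x"
    and BC: "\<And>x. x \<in> carrier_vec n \<Longrightarrow> real_mat B *\<^sub>v (C *\<^sub>v x) = x"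
    using real_inverse[OF B dB] by blast
  have e: "real_mat (A * B) *\<^sub>v x = real_mat A *\<^sub>v (real_mat B *\<^sub>v x)" if "x \<in> carrier_vec n" for x
    unfolding real_mat_mult[OF A B]
    by (rule assoc_mult_mat_vec[of _ m n _ n]) (use A B that in auto)
  have 0: "C *\<^sub>v 0\<^sub>v n = 0\<^sub>v n" "real_mat B *\<^sub>v 0\<^sub>v n = 0\<^sub>v n"
    using C R by (auto intro!: eq_vecI)
  have Cc: "C *\<^sub>v x \<in> carrier_vec n" "real_mat B *\<^sub>v x \<in> carrier_vec n"
    if "x \<in> carrier_vec n" for x using C R that by auto
  show ?thesis unfolding int_rank_eq_cols_iff[OF A] int_rank_eq_cols_iff[OF AB]
    by (metis BC CB Cc 0 e)
qed

lemma SHC_mult_prime_step: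
  assumes A: "A \<in> carrier_mat m n" and rank: "int_rank A = n"
    and p: "p \<noteq> 0" and j: "j < n" and shc: "SHC A"
  shows "SHC (A * prime_step n j p v)"
proof (rule SHC_mult_cyclic[OF A rank prime_step_carrier])
  show "\<exists>y \<in> carrier_vec n. z = prime_step n j p v *\<^sub>v y"
    if "z \<in> carrier_vec n" "det (prime_step n j p v) dvd z $ j" for z
    using prime_step_image[OF j that(1) _ p] that(2) by (simp add: det_prime_step[OF j])
qed (use p j shc in \<open>auto simp: det_prime_step\<close>)

text \<open>
  Here \<open>B \<int>\<^sup>n = \<int>\<^sup>n\<close>, with preimages given by the adjugate, and \<open>\<kappa> = 0\<close> does.
\<close>

lemma SHC_mult_unimodular:
  assumes A: "A \<in> carrier_mat m n" and rank: "int_rank A = n"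
    and B: "B \<in> carrier_mat n n" and dB: "\<bar>det B\<bar> = 1" and shc: "SHC A"
  shows "SHC (A * B)"
proof (rule SHC_mult_cyclic[OF A rank B, of "\<lambda>_. 0"])
  fix z :: "int vec" assume z: "z \<in> carrier_vec n"
  have dd: "det B * det B = 1" using dB by (metis abs_mult_self_eq mult_1)
  note adj = adj_mat[OF B]
  let ?y = "det B \<cdot>\<^sub>v (adj_mat B *\<^sub>v z)"
  have ac: "adj_mat B *\<^sub>v z \<in> carrier_vec n" using adj(1) z by simp
  have "B *\<^sub>v ?y = det B \<cdot>\<^sub>v (B *\<^sub>v (adj_mat B *\<^sub>v z))" by (rule mult_mat_vec_smult[OF B ac])
  also have "B *\<^sub>v (adj_mat B *\<^sub>v z) = (det B \<cdot>\<^sub>m 1\<^sub>m n) *\<^sub>v z"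
    using assoc_mult_mat_vec[OF B adj(1) z] adj(2) by simp
  also have "\<dots> = det B \<cdot>\<^sub>v z" by (rule eq_vecI) (use z in auto)
  also have "det B \<cdot>\<^sub>v \<dots> = z" using dd by (simp add: smult_smult_assoc)
  finally show "\<exists>y \<in> carrier_vec n. z = B *\<^sub>v y" using ac by (intro bexI[of _ ?y]) auto
qed (use dB shc in auto)

section \<open>Reduction to prime factors\<close>

text \<open>
  Induction on \<open>\<bar>det B\<bar>\<close>: a prime divisor of the determinant is split off \<open>B\<close> on the right, the remaining
  left factor is covered by the induction hypothesis.
\<close>

lemma SHC_mult:
  assumes A: "A \<in> carrier_mat m n" and rank: "int_rank A = n" and shc: "SHC A"
  shows "B \<in> carrier_mat n n \<Longrightarrow> det B \<noteq> 0 \<Longrightarrow> SHC (A * B)"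
proof (induction "nat \<bar>det B\<bar>" arbitrary: B rule: less_induct)
  case less
  note B = less.prems(1) and dB = less.prems(2)
  show ?case
  proof (cases "\<bar>det B\<bar> = 1")
    case True
    then show ?thesis by (rule SHC_mult_unimodular[OF A rank B _ shc])
  next
    case False
    then obtain p where p: "prime p" "p dvd det B" using prime_divisor_exists[of "det B"] dB by auto
    have "p dvd det (submatrix B I UNIV)" if "I \<subseteq> {..<n}" "card I = n" for I
    proof -
      have "I = {..<n}" using that card_subset_eq[of "{..<n}" I] by auto
      then show ?thesis using p submatrix_all_rows[OF B] by simp
    qed
    from extract_prime_step[OF B p(1) this] obtain B' j v where B': "B' \<in> carrier_mat n n" and j: "j < n"
      and BE: "B = B' * prime_step n j p v" by blast
    have p0: "p \<noteq> 0" "p > 1" using p(1) prime_gt_1_int by auto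
    have det: "det B = det B' * p"
      unfolding BE det_mult[OF B' prime_step_carrier] det_prime_step[OF j] ..
    have dB': "det B' \<noteq> 0" using det dB by auto
    have "\<bar>det B'\<bar> * 1 < \<bar>det B'\<bar> * p" by (rule mult_strict_left_mono) (use p0 dB' in auto)
    then have "nat \<bar>det B'\<bar> < nat \<bar>det B\<bar>" using p0 by (simp add: det abs_mult)
    from less.hyps[OF this B' dB'] have "SHC (A * B')" .
    moreover have "A * B' \<in> carrier_mat m n" "int_rank (A * B') = n"
      using A B' int_rank_mult[OF A B' dB'] rank by auto
    ultimately have "SHC (A * B' * prime_step n j p v)" using SHC_mult_prime_step p0(1) j by blast
    moreover have "A * B' * prime_step n j p v = A * B"
      unfolding BE by (rule assoc_mult_mat[OF A B' prime_step_carrier])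
    ultimately show ?thesis by simp
  qed
qed

text \<open>
  Induction on the gcd of the maximal minors, which is nonzero by full rank: splitting off a prime divisor
  \<open>p\<close> divides it by \<open>p\<close> and keeps the rank.
\<close>

lemma SHC_if_gcd_1_suffices:
  assumes gcd1: "\<And>A. A \<in> carrier_mat m n \<Longrightarrow> int_rank A = n \<Longrightarrow> mat_gcd A = 1 \<Longrightarrow> SHC A"
    and nm: "n \<le> m"
  shows "A \<in> carrier_mat m n \<Longrightarrow> int_rank A = n \<Longrightarrow> SHC A"
proof (induction "nat (mat_gcd A)" arbitrary: A rule: less_induct)
  case less
  note A = less.prems(1) and rank = less.prems(2)
  let ?D = "(\<lambda>I. det (submatrix A I UNIV)) ` {I. I \<subseteq> {..<m} \<and> card I = n}"
  have gcd: "mat_gcd A = Gcd ?D" by (rule mat_gcd_tall[OF A nm])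
  show ?case
  proof (cases "mat_gcd A = 1")
    case True
    then show ?thesis by (rule gcd1[OF A rank])
  next
    case False
    obtain I where I: "I \<subseteq> {..<m}" "card I = n" "det (submatrix A I UNIV) \<noteq> 0"
      using injective_imp_nonzero_minor[OF A full_rank_imp_injective[OF A rank]] by blast
    then have "mat_gcd A dvd det (submatrix A I UNIV)" unfolding gcd by (intro Gcd_dvd) auto
    then have g0: "mat_gcd A \<noteq> 0" using I(3) by auto
    moreover have "mat_gcd A \<ge> 0" unfolding gcd by simp
    ultimately have "\<bar>mat_gcd A\<bar> \<noteq> 1" using False by simp
    then obtain p where p: "prime p" "p dvd mat_gcd A"
      using prime_divisor_exists[of "mat_gcd A"] g0 by auto
    have "p dvd det (submatrix A I UNIV)" if "I \<subseteq> {..<m}" "card I = n" for I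
      using p(2) unfolding gcd by (rule dvd_trans) (use that in \<open>auto intro: Gcd_dvd\<close>)
    from extract_prime_step[OF A p(1) this] obtain A' j v where A': "A' \<in> carrier_mat m n" and j: "j < n"
      and AE: "A = A' * prime_step n j p v" by blast
    have p0: "p \<noteq> 0" "p > 1" using p(1) prime_gt_1_int by auto
    have g: "mat_gcd A = p * mat_gcd A'"
      unfolding AE mat_gcd_mult[OF A' prime_step_carrier nm] det_prime_step[OF j] using p0 by simp
    have "p * mat_gcd A' > 0" using g g0 \<open>mat_gcd A \<ge> 0\<close> by linarith
    then have "mat_gcd A' > 0" using p0 by (simp add: zero_less_mult_iff)
    then have "1 * mat_gcd A' < p * mat_gcd A'" by (intro mult_strict_right_mono) (use p0 in auto)
    then have "nat (mat_gcd A') < nat (mat_gcd A)" using g \<open>mat_gcd A' > 0\<close> by simp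
    moreover have rank': "int_rank A' = n"
      using rank int_rank_mult[OF A' prime_step_carrier] unfolding AE by (simp add: det_prime_step[OF j] p0)
    ultimately have "SHC A'" using less.hyps A' by blast
    then show ?thesis unfolding AE by (rule SHC_mult_prime_step[OF A' rank' p0(1) j])
  qed
qed

lemma invertible_real_mat_det:
  assumes B: "B \<in> carrier_mat n n" and inv: "invertible_mat (real_mat B)"
  shows "det B \<noteq> 0"
proof -
  have R: "real_mat B \<in> carrier_mat n n" using B by simp
  from inv obtain C where C: "real_mat B * C = 1\<^sub>m n" "C * real_mat B = 1\<^sub>m (dim_row C)"
    using R unfolding invertible_mat_def inverts_mat_def by auto
  have "dim_col C = n" using arg_cong[OF C(1), of dim_col] by simp
  moreover have "dim_row C = n" using arg_cong[OF C(2), of dim_col] R by simp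
  ultimately have "C \<in> carrier_mat n n" by auto
  from det_mult[OF R this] C(1) have "det (real_mat B) * det C = 1" by simp
  then show ?thesis by auto
qed

theorem proposition1p6:
  shows "(\<forall>m n (A :: int mat) (B :: int mat).
            full_col_rank m n A \<longrightarrow> B \<in> carrier_mat n n \<longrightarrow> invertible_mat (real_mat B) \<longrightarrow>
            SHC A \<longrightarrow> SHC (A * B)) \<and>
         ((\<forall>m n (A :: int mat). full_col_rank m n A \<and> mat_gcd A = 1 \<longrightarrow> SHC A) \<longrightarrow>
          (\<forall>m n (A :: int mat). full_col_rank m n A \<longrightarrow> SHC A))"
proof (intro conjI allI impI)
  fix m n and A B :: "int mat"
  assume "full_col_rank m n A" "B \<in> carrier_mat n n" "invertible_mat (real_mat B)" "SHC A"
  then show "SHC (A * B)"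
    using SHC_mult[of A m n B] invertible_real_mat_det[of B n] by (auto simp: full_col_rank_def)
next
  fix m n and A :: "int mat"
  assume gcd1: "\<forall>m n (A :: int mat). full_col_rank m n A \<and> mat_gcd A = 1 \<longrightarrow> SHC A"
    and A: "full_col_rank m n A"
  show "SHC A"
    by (rule SHC_if_gcd_1_suffices[of m n]) (use gcd1 A in \<open>auto simp: full_col_rank_def\<close>)
qed

end
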